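(* Let $\Omega\subset\mathbb{R}$ be a union of two disjoint intervals of non-zero length, with Lebesgue measure $|\Omega|=1$. Then $\Omega$ has a spectrum if and only if $\Omega$ tiles $\mathbb{R}$ by translations.
   Context: A Borel set $\Omega\subset\mathbb{R}$ of positive measure is said to tile $\mathbb{R}$ by translations if there is a discrete set $T\subset\mathbb{R}$ such that, up to sets of Lebesgue measure $0$, the sets $\Omega+t$, $t\in T$, are disjoint and $\bigcup_{t\in T}(\Omega+t)=\mathbb{R}$. For a Borel set $\Omega\subset\mathbb{R}$ with $|\Omega|=1$, a set $\Lambda=\{\lambda_k:k\in\mathbb{Z}\}\subset\mathbb{R}$ (with the $\lambda_k$ distinct) is a spectrum for $\Omega$ if the functions $\{e^{2\pi i\lambda_kx}\}_{k\in\mathbb{Z}}$ form an orthonormal basis for $L^2(\Omega)$. *)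

theory Defs
  imports "HOL-Analysis.Analysis"
begin

definition square_integrable :: "'a measure \<Rightarrow> ('a \<Rightarrow> complex) \<Rightarrow> bool" where
  "square_integrable M f \<longleftrightarrow>
     f \<in> borel_measurable M \<and> integrable M (\<lambda>x. (cmod (f x))\<^sup>2)"

definition L2_inner :: "'a measure \<Rightarrow> ('a \<Rightarrow> complex) \<Rightarrow> ('a \<Rightarrow> complex) \<Rightarrow> complex" where
  "L2_inner M f g = (\<integral>x. f x * cnj (g x) \<partial>M)"

definition L2_norm :: "'a measure \<Rightarrow> ('a \<Rightarrow> complex) \<Rightarrow> real" where
  "L2_norm M f = sqrt (\<integral>x. (cmod (f x))\<^sup>2 \<partial>M)"

(* An orthonormal family in L^2(M) whose linear span is dense. We work with representatives:
   functions equal almost everywhere are at L2_norm-distance 0. *)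
definition L2_orthonormal_basis :: "'a measure \<Rightarrow> ('i \<Rightarrow> 'a \<Rightarrow> complex) \<Rightarrow> bool" where
  "L2_orthonormal_basis M e \<longleftrightarrow>
     (\<forall>i. square_integrable M (e i)) \<and>
     (\<forall>i j. L2_inner M (e i) (e j) = (if i = j then 1 else 0)) \<and>
     (\<forall>f \<epsilon>. square_integrable M f \<longrightarrow> \<epsilon> > 0 \<longrightarrow>
        (\<exists>F c. finite F \<and> L2_norm M (\<lambda>x. f x - (\<Sum>i\<in>F. c i * e i x)) < \<epsilon>))"

(* L^2(\<Omega>) is taken over restrict_space lborel \<Omega>, so \<Omega> is meant to be a Borel set. *)
definition is_spectrum :: "real set \<Rightarrow> real set \<Rightarrow> bool" where
  "is_spectrum \<Lambda> \<Omega> \<longleftrightarrow>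
     (\<exists>l :: int \<Rightarrow> real. inj l \<and> \<Lambda> = range l \<and>
        L2_orthonormal_basis (restrict_space lborel \<Omega>)
          (\<lambda>k x. exp (2 * of_real pi * \<i> * of_real (l k) * of_real x)))"

definition has_spectrum :: "real set \<Rightarrow> bool" where
  "has_spectrum \<Omega> \<longleftrightarrow> (\<exists>\<Lambda>. is_spectrum \<Lambda> \<Omega>)"

(* \<Omega> is meant to be Borel. A discrete T is countable, so every set below is then Borel,
   and null_sets lborel captures Lebesgue measure 0. *)
definition tiles_by_translations :: "real set \<Rightarrow> bool" where
  "tiles_by_translations \<Omega> \<longleftrightarrow>
     (\<exists>T :: real set. discrete T \<and>
        (\<forall>s\<in>T. \<forall>t\<in>T. s \<noteq> t \<longrightarrow>
           (\<lambda>x. x + s) ` \<Omega> \<inter> (\<lambda>x. x + t) ` \<Omega> \<in> null_sets lborel) \<and>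
        UNIV - (\<Union>t\<in>T. (\<lambda>x. x + t) ` \<Omega>) \<in> null_sets lborel)"

end

theory Submission
  imports Defs
begin

text \<open>
  Up to finitely many points, \<open>\<Omega>\<close> is a union of intervals \<open>(p, q)\<close> and \<open>(u, v)\<close> with
  \<open>q \<le> u\<close> and \<open>(q - p) + (v - u) = 1\<close>. Both properties in the theorem turn out to be equivalent
  to one arithmetic condition, here called \<open>commensurable\<close>: either the gap \<open>u - q\<close> is an integer,
  or both intervals have length \<open>1/2\<close> and \<open>2 (u - p)\<close> is an integer.

  \<^emph>\<open>Tilings.\<close> In a tiling, the right end of each piece is the left end of another piece. If the
  two lengths differ, two long pieces or two short pieces can never be neighbours: the partners of
  two adjacent short pieces would overlap, and the partners of two adjacent long pieces would leave
  a hole between them that only short pieces could fill. So long and short pieces alternate, and the gap between the two pieces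
  of one translate has integer length. If the lengths are equal, all left ends lie in a coset of
  \<open>\<int>/2\<close> (\<open>packed_intervals_arithmetic\<close>). Conversely \<open>\<int>\<close> is a tiling set in the first case, and a
  union of cosets of \<open>n \<int>\<close> in the second, where \<open>n = 2 (u - p)\<close>.

  \<^emph>\<open>Spectra give commensurability.\<close> Put \<open>r = q - p\<close>, \<open>s = v - u\<close>, \<open>a = u - p\<close> and
  \<open>e(x) = exp (2 \<pi> i x)\<close>. Two exponentials whose frequencies differ by \<open>t\<close> are orthogonal on
  \<open>\<Omega>\<close> only if \<open>e(t r) + e(t (a + s)) = 1 + e(t a)\<close>, an equality between two sums of two
  unimodular numbers, so that the summands agree in pairs or both sums vanish. For a set of
  frequencies all of whose differences satisfy this, there are two possibilities
  (\<open>frequencies_in_two_classes\<close>): all differences are integers, or all frequencies lie in two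
  classes such that, inside each class, the differences \<open>t\<close> make \<open>t r\<close>, \<open>t s\<close> and \<open>t a\<close> integers.
  In both cases all the exponentials obey a linear relation between their values at a few
  translates of a small cell, and completeness excludes this if the translates are disjoint and
  contained in \<open>\<Omega>\<close> (\<open>separated_cells_independent\<close>). Integer differences leave one degree of
  freedom on two cells at an integer distance, and such cells exist unless \<open>u - q\<close> is an integer.
  Two classes leave two degrees of freedom on three cells at distances in \<open>\<int> r + \<int> s + \<int> a\<close>, and such
  cells exist unless \<open>r = s = 1/2\<close> and \<open>2 a\<close> is an integer.

  \<^emph>\<open>Commensurability gives spectra.\<close> If the gap is an integer, \<open>\<Omega>\<close> is a rearrangement of a unit
  interval by integer translations, which the exponentials with integer frequencies do not notice;
  so \<open>\<int>\<close> is a spectrum. In the other case \<open>2 \<int> \<union> (2 \<int> + 1/n)\<close> is a spectrum: a pair of functions on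
  an interval of length \<open>1/2\<close> is the sum of a pair \<open>(A, A)\<close> and a pair \<open>(D, - D)\<close>, and these two
  kinds are expanded in the two cosets. What is used from Fourier analysis is the density of
  trigonometric polynomials in \<open>L\<^sup>2\<close> of a period (\<open>trig_polynomials_dense\<close>), which
  follows from the Stone-Weierstrass theorem on the unit circle.
\<close>

section \<open>The commensurability criterion\<close>

locale two_intervals =
  fixes \<Omega> :: "real set" and p q u v :: real
  assumes borel_\<Omega>: "\<Omega> \<in> sets borel"
    and pq: "p < q" and qu: "q \<le> u" and uv: "u < v"
    and total_length: "(q - p) + (v - u) = 1"
    and inner: "{p<..<q} \<union> {u<..<v} \<subseteq> \<Omega>"
    and outer: "\<Omega> \<subseteq> {p..q} \<union> {u..v}"
begin

text \<open>The common arithmetic meaning of being spectral and of tiling.\<close>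
definition commensurable :: bool where
  "commensurable \<longleftrightarrow> u - q \<in> \<int> \<or> (q - p = 1/2 \<and> 2 * (u - p) \<in> \<int>)"

end

lemma interval_endpoints:
  fixes I :: "real set"
  assumes I: "is_interval I" "emeasure lborel I \<noteq> 0" "emeasure lborel I \<le> 1"
  obtains p q where "p < q" "{p<..<q} \<subseteq> I" "I \<subseteq> {p..q}" "emeasure lborel I = ennreal (q - p)"
proof -
  have meas: "I \<in> sets lborel" using real_interval_borel_measurable[OF I(1)] by simp
  have conv: "{x..y} \<subseteq> I" if "x \<in> I" "y \<in> I" for x y
    using I(1) that unfolding is_interval_1 by (meson atLeastAtMost_iff subsetI)
  have ne: "I \<noteq> {}" using I(2) by auto
  then obtain x0 where x0: "x0 \<in> I" by blast
  have width: "\<bar>y - x0\<bar> \<le> 1" if "y \<in> I" for y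
  proof -
    have "ennreal (y - x) \<le> 1" if "x \<in> I" "y \<in> I" "x \<le> y" for x y
      using order_trans[OF emeasure_mono[OF conv[OF that(1,2)] meas] I(3)] that(3) by simp
    then have "y - x \<le> 1" if "x \<in> I" "y \<in> I" "x \<le> y" for x y
      using that by (metis ennreal_1 ennreal_le_iff zero_le_one)
    from this[of x0 y] this[of y x0] show ?thesis using x0 \<open>y \<in> I\<close> by linarith
  qed
  have bdd: "bdd_above I" "bdd_below I"
  proof -
    show "bdd_above I" by (rule bdd_aboveI[of _ "x0 + 1"]) (use width in force)
    show "bdd_below I" by (rule bdd_belowI[of _ "x0 - 1"]) (use width in force)
  qed
  define p q where "p = Inf I" and "q = Sup I"
  have sub: "I \<subseteq> {p..q}" unfolding p_def q_def using bdd by (auto intro: cInf_lower cSup_upper)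
  have sup: "{p<..<q} \<subseteq> I"
  proof
    fix x assume "x \<in> {p<..<q}"
    then obtain y z where "y \<in> I" "y < x" "z \<in> I" "x < z"
      using ne bdd unfolding p_def q_def by (auto simp: cInf_less_iff less_cSup_iff)
    then show "x \<in> I" using conv[of y z] by auto
  qed
  have "p \<le> q" using sub x0 by force
  have "emeasure lborel I = ennreal (q - p)"
  proof (rule antisym)
    show "emeasure lborel I \<le> ennreal (q - p)" using emeasure_mono[OF sub, of lborel] \<open>p \<le> q\<close> by simp
    show "ennreal (q - p) \<le> emeasure lborel I" using emeasure_mono[OF sup meas] \<open>p \<le> q\<close> by simp
  qed
  moreover have "p < q" using calculation I(2) \<open>p \<le> q\<close> by (cases "p = q") auto
  ultimately show ?thesis using that sub sup by blast
qed

lemma two_intervals_ordered: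
  fixes I J :: "real set"
  assumes I: "is_interval I" and J: "is_interval J"
    and nz: "emeasure lborel I \<noteq> 0" "emeasure lborel J \<noteq> 0"
    and disj: "I \<inter> J = {}" and total: "emeasure lborel (I \<union> J) = 1"
  shows "\<exists>p q u v. two_intervals (I \<union> J) p q u v"
proof -
  have meas: "I \<in> sets borel" "J \<in> sets borel"
    using I J by (auto intro: real_interval_borel_measurable)
  have sum: "emeasure lborel I + emeasure lborel J = 1"
    using plus_emeasure[of I lborel J] meas disj total by simp
  have le: "emeasure lborel I \<le> 1" "emeasure lborel J \<le> 1"
    using le_iff_add sum by (metis, metis add.commute le_iff_add)
  obtain p q where pq: "p < q" "{p<..<q} \<subseteq> I" "I \<subseteq> {p..q}" "emeasure lborel I = ennreal (q - p)"
    using interval_endpoints[OF I nz(1) le(1)] .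
  obtain u v where uv: "u < v" "{u<..<v} \<subseteq> J" "J \<subseteq> {u..v}" "emeasure lborel J = ennreal (v - u)"
    using interval_endpoints[OF J nz(2) le(2)] .
  have "ennreal ((q - p) + (v - u)) = 1"
    using sum pq uv by (simp add: ennreal_plus)
  then have len: "(q - p) + (v - u) = 1" using ennreal_eq_1 by simp
  have "{p<..<q} \<inter> {u<..<v} = {}" using pq uv disj by blast
  then have "{max p u<..<min q v} = {}" by (auto simp: set_eq_iff)
  then have "q \<le> u \<or> v \<le> p" using pq uv by (auto simp: min_def max_def split: if_splits)
  then show ?thesis
  proof
    assume "q \<le> u"
    then have "two_intervals (I \<union> J) p q u v"
      using meas pq uv len by unfold_locales auto
    then show ?thesis by blast
  next
    assume "v \<le> p"
    then have "two_intervals (I \<union> J) u v p q"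
      using meas pq uv len by unfold_locales auto
    then show ?thesis by blast
  qed
qed

section \<open>Tilings\<close>

text \<open>
  The combinatorial core of the tiling problem: \<open>T\<close> is the set of left ends of the
  pieces \<open>[x, x + r)\<close>, whose partners are \<open>[x + a, x + a + s)\<close>. The assumptions say that pieces do
  not overlap and that the right end of each piece is the left end of some piece. If \<open>r \<noteq> s\<close> the two
  kinds of pieces must alternate, so that \<open>T\<close> is closed under adding \<open>r + s = 1\<close>; a partner that does not
  sit at an integer distance after the end of its own piece would then overlap a translate of that
  piece. If \<open>r = s\<close>, stepping from piece to piece by \<open>1/2\<close> must hit the partner exactly.
\<close>
lemma packed_intervals_arithmetic:
  fixes T :: "real set" and r s a :: real
  assumes r: "0 < r" and s: "0 < s" and sum: "r + s = 1" and ra: "r \<le> a" and ne: "T \<noteq> {}"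
    and sep: "\<And>x y. x \<in> T \<Longrightarrow> y \<in> T \<Longrightarrow> x < y \<Longrightarrow> r \<le> y - x \<and> s \<le> y - x"
    and AB: "\<And>x y. x \<in> T \<Longrightarrow> y \<in> T \<Longrightarrow> x + r \<le> y + a \<or> y + a + s \<le> x"
    and fillA: "\<And>x. x \<in> T \<Longrightarrow> x + r \<in> T \<or> x + r - a \<in> T"
    and fillB: "\<And>x. x \<in> T \<Longrightarrow> x + a + s \<in> T \<or> x + s \<in> T"
  shows "a - r \<in> \<int> \<or> r = 1/2 \<and> 2 * a \<in> \<int>"
proof (cases "r = s")
  case False
  \<comment> \<open>Each piece of length \<open>r\<close> is followed by one of length \<open>s\<close>, and conversely.\<close>
  have step: "x + r - a \<in> T \<and> x + a + s \<in> T" if x: "x \<in> T" for x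
  proof (cases "r < s")
    case True
    have A: "y + r - a \<in> T" if "y \<in> T" for y
      using fillA[OF that] sep[OF that, of "y + r"] True r by auto
    have "x + s \<notin> T"
      using AB[of "x + s" "x + r - a"] A[OF x] r s by auto
    then show ?thesis using A[OF x] fillB[OF x] by auto
  next
    case nless: False
    have B: "y + a + s \<in> T" if "y \<in> T" for y
      using fillB[OF that] sep[OF that, of "y + s"] nless False s by auto
    have "x + r \<notin> T"
      using AB[of "x + a + s" "x + r"] B[OF x] r s by auto
    then show ?thesis using B[OF x] fillA[OF x] by auto
  qed
  obtain x where x: "x \<in> T" using ne by blast
  have shift: "x + real k \<in> T" for k
  proof (induction k)
    case (Suc k)
    have "(x + real k + r - a) + a + s \<in> T" using step step Suc by blast
    moreover have "(x + real k + r - a) + a + s = x + real (Suc k)" using sum by simp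
    ultimately show ?case by metis
  qed (use x in simp)
  define k where "k = nat \<lfloor>a - r\<rfloor>"
  have k: "real k \<le> a - r" "a - r < real k + 1"
    using ra unfolding k_def by linarith+
  have "x + real (Suc k) + r \<le> x + a \<or> x + a + s \<le> x + real (Suc k)"
    using AB[OF shift x] .
  then have "a - r = real k" using k sum by auto
  then show ?thesis by (metis Ints_of_nat)
next
  case True
  then have half: "r = 1/2" "s = 1/2" using sum by auto
  obtain x where x: "x \<in> T" using ne by blast
  have shift: "x + real k / 2 \<in> T \<or> x + real k / 2 - a \<in> T" for k
  proof (induction k)
    case (Suc k)
    have eq: "x + real (Suc k) / 2 = x + real k / 2 + r" by (simp add: half field_simps)
    from Suc show ?case
    proof
      assume "x + real k / 2 \<in> T"
      from fillA[OF this] show ?thesis unfolding eq by simp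
    next
      assume "x + real k / 2 - a \<in> T"
      from fillB[OF this] show ?thesis unfolding eq half by (simp add: algebra_simps)
    qed
  qed (use x in simp)
  define k where "k = nat \<lfloor>2 * a\<rfloor>"
  have k: "real k \<le> 2 * a" "2 * a < real k + 1"
    using ra r unfolding k_def by linarith+
  have "2 * a = real k"
  proof (rule ccontr)
    assume "2 * a \<noteq> real k"
    with k have lt: "real k < 2 * a" by simp
    from shift[of k] show False
    proof
      assume "x + real k / 2 \<in> T"
      from AB[OF this x] show False using half k lt by auto
    next
      assume "x + real k / 2 - a \<in> T"
      from sep[OF this x] show False using half k lt by auto
    qed
  qed
  then show ?thesis using half by (metis Ints_of_nat)
qed

context two_intervals
begin

text \<open>
  The work here is to extract from the measure-theoretic definition that the right end \<open>x\<close> of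
  a piece is a left end. Distinct elements of \<open>T\<close> are at least the length of a piece apart, so no
  left end lies in some interval \<open>(x, x + d)\<close>. If no piece started at \<open>x\<close>, this interval would
  then be free of pieces altogether, against the covering property.
\<close>
lemma commensurable_if_tiles:
  assumes "tiles_by_translations \<Omega>"
  shows commensurable
proof -
  obtain T where
    packing: "\<And>s t. s \<in> T \<Longrightarrow> t \<in> T \<Longrightarrow> s \<noteq> t \<Longrightarrow>
      (\<lambda>x. x + s) ` \<Omega> \<inter> (\<lambda>x. x + t) ` \<Omega> \<in> null_sets lborel"
    and covering: "UNIV - (\<Union>t\<in>T. (\<lambda>x. x + t) ` \<Omega>) \<in> null_sets lborel"
    using assms unfolding tiles_by_translations_def by blast
  have null_Ioo: "d \<le> c" if N: "N \<in> null_sets lborel" and sub: "{c<..<d} \<subseteq> N" for c d :: real and N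
  proof (rule ccontr)
    assume "\<not> d \<le> c"
    moreover have "{c<..<d} \<in> null_sets lborel" by (rule null_sets_subset[OF N _ sub]) simp
    ultimately show False by (auto dest: null_setsD1)
  qed
  have disj: "y' \<le> x \<or> x' \<le> y"
    if st: "s \<in> T" "t \<in> T" "s \<noteq> t" and "x < x'" "y < y'"
      and X: "{x - s<..<x' - s} \<subseteq> \<Omega>" and Y: "{y - t<..<y' - t} \<subseteq> \<Omega>" for s t x x' y y'
  proof -
    have "{max x y<..<min x' y'} \<subseteq> (\<lambda>x. x + s) ` \<Omega> \<inter> (\<lambda>x. x + t) ` \<Omega>"
    proof
      fix z assume z: "z \<in> {max x y<..<min x' y'}"
      then have "z - s \<in> \<Omega>" "z - t \<in> \<Omega>" using X Y by auto
      then show "z \<in> (\<lambda>x. x + s) ` \<Omega> \<inter> (\<lambda>x. x + t) ` \<Omega>"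
        by (metis IntI diff_add_cancel image_eqI)
    qed
    then have "min x' y' \<le> max x y" using null_Ioo packing[OF st] by blast
    then show ?thesis using that(4,5) by auto
  qed
  have I: "{p<..<q} \<subseteq> \<Omega>" and J: "{u<..<v} \<subseteq> \<Omega>" using inner by auto
  have sep: "q - p \<le> t - s \<and> v - u \<le> t - s" if "s \<in> T" "t \<in> T" "s < t" for s t
    using disj[of s t "p + s" "q + s" "p + t" "q + t"] disj[of s t "u + s" "v + s" "u + t" "v + t"]
      that I J pq uv by auto
  have AB: "q + s \<le> u + t \<or> v + t \<le> p + s" if "s \<in> T" "t \<in> T" for s t
    using disj[of s t "p + s" "q + s" "u + t" "v + t"] that I J pq uv qu by (cases "s = t") auto
  \<comment> \<open>Since translates are separated, at most one of the points \<open>c + t\<close> lies in \<open>(x, x + (q - p))\<close>.\<close>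
  have gap: "\<exists>d>0. \<forall>t\<in>T. c + t \<le> x \<or> x + d \<le> c + t" for c x
  proof (cases "\<exists>t\<in>T. x < c + t \<and> c + t < x + (q - p)")
    case True
    then obtain t where t: "t \<in> T" "x < c + t" "c + t < x + (q - p)" by blast
    have "c + t' \<le> x \<or> c + t \<le> c + t'" if "t' \<in> T" for t'
      using sep[of t' t] t that by force
    then show ?thesis using t by (intro exI[of _ "c + t - x"]) auto
  next
    case False
    then show ?thesis using pq by (intro exI[of _ "q - p"]) force
  qed
  have fill: "\<exists>t\<in>T. p + t = x \<or> u + t = x"
    if left: "\<And>t. t \<in> T \<Longrightarrow> \<not> (p + t < x \<and> x < q + t) \<and> \<not> (u + t < x \<and> x < v + t)" for x
  proof (rule ccontr)
    assume none: "\<not> ?thesis"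
    obtain d1 where d1: "d1 > 0" "\<And>t. t \<in> T \<Longrightarrow> p + t \<le> x \<or> x + d1 \<le> p + t" using gap by blast
    obtain d2 where d2: "d2 > 0" "\<And>t. t \<in> T \<Longrightarrow> u + t \<le> x \<or> x + d2 \<le> u + t" using gap by blast
    \<comment> \<open>A piece meeting this interval would contain \<open>x\<close> in its interior, start at \<open>x\<close>, or start inside.\<close>
    have "{x<..<x + min d1 d2} \<subseteq> UNIV - (\<Union>t\<in>T. (\<lambda>x. x + t) ` \<Omega>)"
    proof
      fix y assume y: "y \<in> {x<..<x + min d1 d2}"
      have False if t: "t \<in> T" and z: "z \<in> \<Omega>" "y = z + t" for t z
      proof -
        have "p + t \<noteq> x" "u + t \<noteq> x" using none t by auto
        moreover have "p \<le> z \<and> z \<le> q \<or> u \<le> z \<and> z \<le> v" using z outer by auto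
        ultimately show False using left[OF t] d1(2)[OF t] d2(2)[OF t] y z by auto
      qed
      then show "y \<in> UNIV - (\<Union>t\<in>T. (\<lambda>x. x + t) ` \<Omega>)" by blast
    qed
    then have "x + min d1 d2 \<le> x" using null_Ioo covering by blast
    then show False using d1(1) d2(1) by auto
  qed
  have fillA: "s + (q - p) \<in> T \<or> s + (q - p) - (u - p) \<in> T" if s: "s \<in> T" for s
  proof -
    have "\<not> (p + t < q + s \<and> q + s < q + t) \<and> \<not> (u + t < q + s \<and> q + s < v + t)" if t: "t \<in> T" for t
      using AB[OF s t] sep[OF s t] pq uv by auto
    from fill[OF this] obtain t where t: "t \<in> T" "p + t = q + s \<or> u + t = q + s" by blast
    then have "t = s + (q - p) \<or> t = s + (q - p) - (u - p)" by auto
    then show ?thesis using t(1) by blast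
  qed
  have fillB: "s + (u - p) + (v - u) \<in> T \<or> s + (v - u) \<in> T" if s: "s \<in> T" for s
  proof -
    have "\<not> (p + t < v + s \<and> v + s < q + t) \<and> \<not> (u + t < v + s \<and> v + s < v + t)" if t: "t \<in> T" for t
      using AB[OF t s] sep[OF s t] pq uv by auto
    from fill[OF this] obtain t where t: "t \<in> T" "p + t = v + s \<or> u + t = v + s" by blast
    then have "t = s + (u - p) + (v - u) \<or> t = s + (v - u)" by auto
    then show ?thesis using t(1) by blast
  qed
  have "T \<noteq> {}"
  proof
    assume "T = {}"
    then show False using null_Ioo[OF covering, of 0 1] by auto
  qed
  then have "(u - p) - (q - p) \<in> \<int> \<or> q - p = 1/2 \<and> 2 * (u - p) \<in> \<int>"
    using pq uv qu total_length sep fillA fillB AB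
    by (intro packed_intervals_arithmetic[of "q - p" "v - u" "u - p" T]) (auto simp: algebra_simps)
  then show ?thesis unfolding commensurable_def by simp
qed

text \<open>
  Replacing \<open>\<Omega>\<close> by the half-open intervals changes each translate in finitely many points, and there
  are only countably many translates, so an exact tiling by the half-open version suffices.
\<close>
lemma tiles_if_exact_tiling:
  assumes T: "T \<subseteq> (\<lambda>i. of_int i / 2) ` UNIV"
    and disj: "\<And>x s t. s \<in> T \<Longrightarrow> t \<in> T \<Longrightarrow> x - s \<in> {p..<q} \<union> {u..<v} \<Longrightarrow>
      x - t \<in> {p..<q} \<union> {u..<v} \<Longrightarrow> s = t"
    and cover: "\<And>x. \<exists>t\<in>T. x - t \<in> {p..<q} \<union> {u..<v}"
  shows "tiles_by_translations \<Omega>"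
proof -
  have "uniform_discrete T"
    unfolding uniform_discrete_def
  proof (intro exI[of _ "1/2"] conjI ballI impI)
    fix x y assume "x \<in> T" "y \<in> T" and d: "dist x y < 1/2"
    then obtain i j :: int where ij: "x = of_int i / 2" "y = of_int j / 2" using T by blast
    then have "\<bar>real_of_int i - real_of_int j\<bar> < 1" using d unfolding ij dist_real_def by argo
    then have "i = j" by linarith
    then show "x = y" using ij by simp
  qed simp
  then have discrete: "discrete T" by (rule uniform_discrete_imp_discrete)
  have "countable T" using T by (rule countable_subset) simp
  define E where "E = {p, q, u, v}"
  have half_open: "\<Omega> \<subseteq> ({p..<q} \<union> {u..<v}) \<union> E" "{p..<q} \<union> {u..<v} \<subseteq> \<Omega> \<union> E"
    using inner outer unfolding E_def by force+
  have "(\<lambda>x. x + s) ` \<Omega> \<inter> (\<lambda>x. x + t) ` \<Omega> \<in> null_sets lborel"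
    if st: "s \<in> T" "t \<in> T" "s \<noteq> t" for s t
  proof -
    have "(\<lambda>x. x + s) ` \<Omega> \<inter> (\<lambda>x. x + t) ` \<Omega> \<subseteq> (\<lambda>x. x + s) ` E \<union> (\<lambda>x. x + t) ` E"
    proof
      fix x assume "x \<in> (\<lambda>x. x + s) ` \<Omega> \<inter> (\<lambda>x. x + t) ` \<Omega>"
      then obtain y z where "y \<in> \<Omega>" "x = y + s" "z \<in> \<Omega>" "x = z + t" by blast
      then have "x - s \<in> \<Omega>" "x - t \<in> \<Omega>" by (metis add_diff_cancel)+
      then have "x - s \<in> E \<or> x - t \<in> E" using disj[of s t x] st half_open by blast
      then show "x \<in> (\<lambda>x. x + s) ` E \<union> (\<lambda>x. x + t) ` E" by (metis UnI1 UnI2 diff_add_cancel image_eqI)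
    qed
    then have "finite ((\<lambda>x. x + s) ` \<Omega> \<inter> (\<lambda>x. x + t) ` \<Omega>)"
      by (rule finite_subset) (simp add: E_def)
    then show ?thesis by (rule finite_imp_null_set_lborel)
  qed
  moreover have "UNIV - (\<Union>t\<in>T. (\<lambda>x. x + t) ` \<Omega>) \<in> null_sets lborel"
  proof -
    have "UNIV - (\<Union>t\<in>T. (\<lambda>x. x + t) ` \<Omega>) \<subseteq> (\<Union>t\<in>T. (\<lambda>x. x + t) ` E)"
    proof
      fix x assume x: "x \<in> UNIV - (\<Union>t\<in>T. (\<lambda>x. x + t) ` \<Omega>)"
      obtain t where t: "t \<in> T" "x - t \<in> {p..<q} \<union> {u..<v}" using cover by blast
      then have "x - t \<in> \<Omega> \<union> E" using half_open by blast
      moreover have "x - t \<notin> \<Omega>"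
        using x t(1) by (metis DiffD2 UN_iff diff_add_cancel image_eqI)
      ultimately show "x \<in> (\<Union>t\<in>T. (\<lambda>x. x + t) ` E)"
        using t(1) by (metis UN_iff UnE diff_add_cancel image_eqI)
    qed
    then have "countable (UNIV - (\<Union>t\<in>T. (\<lambda>x. x + t) ` \<Omega>))"
      by (rule countable_subset) (use \<open>countable T\<close> in \<open>auto simp: E_def\<close>)
    then show ?thesis by (rule countable_imp_null_set_lborel)
  qed
  ultimately show ?thesis using discrete unfolding tiles_by_translations_def by blast
qed

lemma tiles_if_commensurable:
  assumes commensurable
  shows "tiles_by_translations \<Omega>"
  using assms unfolding commensurable_def
proof
  assume "u - q \<in> \<int>"
  then obtain k :: int where k: "u = q + of_int k" by (metis Ints_cases add.commute diff_add_cancel)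
  then have v: "v = p + 1 + of_int k" using total_length by simp
  show ?thesis
  proof (rule tiles_if_exact_tiling[of "range of_int"])
    show "range real_of_int \<subseteq> range (\<lambda>i. real_of_int i / 2)"
    proof safe
      fix i :: int
      have "real_of_int i = real_of_int (2 * i) / 2" by simp
      then show "real_of_int i \<in> range (\<lambda>i. real_of_int i / 2)" by blast
    qed
  next
    fix x s t assume "s \<in> range real_of_int" "t \<in> range real_of_int"
      and x: "x - s \<in> {p..<q} \<union> {u..<v}" "x - t \<in> {p..<q} \<union> {u..<v}"
    then obtain i j :: int where ij: "s = of_int i" "t = of_int j" by auto
    have *: "y = y'" if "of_int y \<le> w" "w < of_int y + 1" "of_int y' \<le> w" "w < of_int y' + 1"
      for y y' :: int and w :: real
      using that by linarith
    \<comment> \<open>Modulo \<open>1\<close>, and up to the shift by \<open>k\<close> of the second interval, \<open>\<Omega>\<close> is \<open>[p, p + 1)\<close>.\<close>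
    have f: "x - of_int i \<in> {p..<q} \<union> {u..<v} \<Longrightarrow>
      \<lfloor>x - p\<rfloor> = i \<and> x - p - i < q - p \<or> \<lfloor>x - p\<rfloor> = i + k \<and> x - p - (i + k) \<ge> q - p" for i :: int
      using pq qu uv v k by (auto simp: floor_eq_iff)
    show "s = t" using f[of i] f[of j] x ij by auto
  next
    fix x
    define i where "i = \<lfloor>x - p\<rfloor>"
    have i: "of_int i \<le> x - p" "x - p < of_int i + 1" unfolding i_def by linarith+
    show "\<exists>t\<in>range real_of_int. x - t \<in> {p..<q} \<union> {u..<v}"
    proof (cases "x - of_int i < q")
      case True
      then have "x - of_int i \<in> {p..<q} \<union> {u..<v}" using i by auto
      then show ?thesis by blast
    next
      case False
      then have "x - of_int (i - k) \<in> {p..<q} \<union> {u..<v}" using i k v by auto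
      then show ?thesis by blast
    qed
  qed
next
  assume half: "q - p = 1/2 \<and> 2 * (u - p) \<in> \<int>"
  then obtain n :: int where n: "2 * (u - p) = of_int n" by (metis Ints_cases)
  have "n > 0" using n pq qu by (metis diff_gt_0_iff_gt less_le_trans mult_pos_pos of_int_0_less_iff zero_less_numeral)
  have ends: "q = p + 1/2" "u = p + n/2" "v = p + n/2 + 1/2"
    using half n total_length by (auto simp: field_simps)
  have piece: "x - of_int i / 2 \<in> {p..<q} \<union> {u..<v} \<longleftrightarrow> i = \<lfloor>2 * (x - p)\<rfloor> \<or> i = \<lfloor>2 * (x - p)\<rfloor> - n"
    for x and i :: int
  proof -
    have "x - of_int i / 2 \<in> {p..<q} \<longleftrightarrow> \<lfloor>2 * (x - p)\<rfloor> = i"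
      unfolding ends floor_eq_iff by (auto simp: field_simps)
    moreover have "x - of_int i / 2 \<in> {u..<v} \<longleftrightarrow> \<lfloor>2 * (x - p)\<rfloor> = i + n"
      unfolding ends floor_eq_iff by (auto simp: field_simps)
    ultimately show ?thesis by auto
  qed
  \<comment> \<open>Translations by \<open>i / 2\<close> with \<open>i mod 2n < n\<close> work: a cell \<open>w\<close> of length \<open>1/2\<close> is covered by the
    first interval of the translate \<open>i = w\<close> or by the second interval of \<open>i = w - n\<close>, and exactly one of
    these two residues modulo \<open>2n\<close> is allowed.\<close>
  have mod1: "(i - n) mod (2 * n) < n" if "\<not> i mod (2 * n) < n" for i
  proof -
    have "i mod (2 * n) < 2 * n" using \<open>n > 0\<close> by simp
    then have "(i mod (2 * n) - n) mod (2 * n) = i mod (2 * n) - n"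
      using that by (intro mod_pos_pos_trivial) auto
    then show ?thesis using \<open>i mod (2 * n) < 2 * n\<close> by (simp add: mod_diff_left_eq)
  qed
  have mod2: "\<not> (i - n) mod (2 * n) < n" if "i mod (2 * n) < n" for i
  proof -
    have "i mod (2 * n) \<ge> 0" using \<open>n > 0\<close> by simp
    have "(i - n) mod (2 * n) = (i mod (2 * n) + n) mod (2 * n)"
      by (simp add: mod_add_left_eq mod_eq_dvd_iff)
    also have "\<dots> = i mod (2 * n) + n"
      using that \<open>i mod (2 * n) \<ge> 0\<close> by (intro mod_pos_pos_trivial) auto
    finally show ?thesis using \<open>i mod (2 * n) \<ge> 0\<close> by simp
  qed
  show ?thesis
  proof (rule tiles_if_exact_tiling[of "(\<lambda>i. of_int i / 2) ` {i. i mod (2 * n) < n}"])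
    fix x s t
    assume "s \<in> (\<lambda>i. real_of_int i / 2) ` {i. i mod (2 * n) < n}"
      "t \<in> (\<lambda>i. real_of_int i / 2) ` {i. i mod (2 * n) < n}"
      "x - s \<in> {p..<q} \<union> {u..<v}" "x - t \<in> {p..<q} \<union> {u..<v}"
    then obtain i j where ij: "s = of_int i / 2" "t = of_int j / 2" "i mod (2 * n) < n" "j mod (2 * n) < n"
      "i = \<lfloor>2 * (x - p)\<rfloor> \<or> i = \<lfloor>2 * (x - p)\<rfloor> - n" "j = \<lfloor>2 * (x - p)\<rfloor> \<or> j = \<lfloor>2 * (x - p)\<rfloor> - n"
      using piece by blast
    then have "i = j" using mod2 by blast
    then show "s = t" using ij by simp
  next
    fix x
    show "\<exists>t\<in>(\<lambda>i. real_of_int i / 2) ` {i. i mod (2 * n) < n}. x - t \<in> {p..<q} \<union> {u..<v}"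
      using mod1[of "\<lfloor>2 * (x - p)\<rfloor>"] by (auto simp only: bex_simps piece) 
  qed auto
qed

end

section \<open>Exponentials and their integrals over two intervals\<close>

text \<open>
  The character of \<open>\<real>\<close> with kernel \<open>\<int>\<close>.
\<close>
definition expi :: "real \<Rightarrow> complex" where
  "expi x = cis (2 * pi * x)"

lemma exp_eq_expi: "exp (2 * of_real pi * \<i> * of_real a * of_real x) = expi (a * x)"
  unfolding expi_def cis_conv_exp by (simp add: algebra_simps)

lemma norm_expi [simp]: "cmod (expi x) = 1"
  by (simp add: expi_def)

lemma expi_neq_0 [simp]: "expi x \<noteq> 0"
  by (simp add: expi_def)

lemma expi_0 [simp]: "expi 0 = 1"
  by (simp add: expi_def)

lemma expi_add: "expi (x + y) = expi x * expi y"
  by (simp add: expi_def cis_mult distrib_left)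

lemma expi_diff: "expi (x - y) = expi x / expi y"
  by (simp add: expi_def cis_divide right_diff_distrib)

lemma cnj_expi: "cnj (expi x) = expi (- x)"
  by (simp add: expi_def cis_cnj)

lemma expi_eq_1_iff: "expi x = 1 \<longleftrightarrow> x \<in> \<int>"
proof
  assume "expi x = 1"
  then have "exp (\<i> * of_real (2 * pi * x)) = 1" by (simp add: expi_def cis_conv_exp)
  then obtain n :: int where "2 * pi * x = of_int (2 * n) * pi" unfolding exp_eq_1 by auto
  then have "x = of_int n" by simp
  then show "x \<in> \<int>" by simp
qed (simp add: expi_def)

lemma expi_eq_iff: "expi x = expi y \<longleftrightarrow> x - y \<in> \<int>"
  by (simp add: expi_eq_1_iff[symmetric] expi_diff)

lemma continuous_on_expi [continuous_intros]:
  "continuous_on S f \<Longrightarrow> continuous_on S (\<lambda>x. expi (f x))"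
  unfolding expi_def by (intro continuous_intros)

lemma borel_measurable_expi [measurable]: "expi \<in> borel_measurable borel"
  by (intro borel_measurable_continuous_onI continuous_intros)

lemma has_vector_derivative_expi:
  "((\<lambda>x. expi (c * x)) has_vector_derivative (2 * pi * \<i> * c * expi (c * x))) (at x within S)"
proof -
  have "((\<lambda>z. exp (2 * pi * \<i> * c * z)) has_field_derivative 2 * pi * \<i> * c * expi (c * x)) (at (of_real x))"
    by (auto intro!: derivative_eq_intros simp: expi_def cis_conv_exp algebra_simps)
  from has_vector_derivative_real_field[OF this, of S]
  show ?thesis by (simp add: expi_def cis_conv_exp algebra_simps)
qed

lemma has_bochner_integral_expi:
  assumes "c \<noteq> 0" "a \<le> b"
  shows "has_bochner_integral lborel (\<lambda>x. indicator {a..b} x *\<^sub>R expi (c * x))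
    ((expi (c * b) - expi (c * a)) / (2 * pi * \<i> * c))"
proof -
  have "((\<lambda>x. expi (c * x) / (2 * pi * \<i> * c)) has_vector_derivative expi (c * x)) (at x within {a..b})" for x
    using has_vector_derivative_mult_right[OF has_vector_derivative_expi[of c x "{a..b}"],
        of "1 / (2 * pi * \<i> * c)"] assms(1) by simp
  from has_bochner_integral_FTC_Icc[OF assms(2) this]
  show ?thesis by (simp add: diff_divide_distrib continuous_intros)
qed

context two_intervals
begin

lemma borel_\<Omega>' [measurable]: "\<Omega> \<in> sets borel" by (rule borel_\<Omega>)

lemma restrictable [simp]: "\<Omega> \<inter> space lborel \<in> sets lborel"
  using borel_\<Omega> by simp

lemma AE_indicator_\<Omega>:
  "AE x in lborel. indicator \<Omega> x = (indicator {p..q} x + indicator {u..v} x :: real)"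
proof -
  have "AE x in lborel. x \<notin> {p, q, u, v}"
    by (intro AE_not_in finite_imp_null_set_lborel) simp
  then show ?thesis
  proof eventually_elim
    case (elim x)
    then have "x \<in> \<Omega> \<longleftrightarrow> x \<in> {p<..<q} \<union> {u<..<v}" "x \<notin> {p..q} \<inter> {u..v}" "x \<in> {p..q} \<longleftrightarrow> x \<in> {p<..<q}"
      "x \<in> {u..v} \<longleftrightarrow> x \<in> {u<..<v}"
      using inner outer qu by (auto; force)+
    then show ?case by (auto simp: indicator_def)
  qed
qed

lemma emeasure_\<Omega>: "emeasure lborel \<Omega> = 1"
proof -
  have "emeasure lborel \<Omega> = (\<integral>\<^sup>+x. ennreal (indicator \<Omega> x) \<partial>lborel)"
    by (simp add: ennreal_indicator)
  also have "\<dots> = (\<integral>\<^sup>+x. ennreal (indicator {p..q} x + indicator {u..v} x) \<partial>lborel)"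
    using AE_indicator_\<Omega> by (intro nn_integral_cong_AE) auto
  also have "\<dots> = ennreal (q - p) + ennreal (v - u)"
    using pq uv by (simp add: ennreal_indicator nn_integral_add)
  also have "\<dots> = 1" using pq uv total_length by (simp flip: ennreal_plus)
  finally show ?thesis .
qed

text \<open>
  Up to the factor \<open>2 \<pi> i t\<close>, the Fourier transform of the indicator function of \<open>\<Omega>\<close> at \<open>- t\<close>; its nonzero
  zeros are the differences of frequencies of orthogonal exponentials.
\<close>
definition endpoint_sum :: "real \<Rightarrow> complex" where
  "endpoint_sum t = (expi (t * q) - expi (t * p)) + (expi (t * v) - expi (t * u))"

lemma integral_expi:
  assumes "t \<noteq> 0"
  shows "(LINT x|restrict_space lborel \<Omega>. expi (t * x)) = endpoint_sum t / (2 * pi * \<i> * t)"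
proof -
  have "(LINT x|restrict_space lborel \<Omega>. expi (t * x)) = (LINT x|lborel. indicator \<Omega> x *\<^sub>R expi (t * x))"
    by (rule integral_restrict_space) simp
  also have "\<dots> = (LINT x|lborel. indicator {p..q} x *\<^sub>R expi (t * x) + indicator {u..v} x *\<^sub>R expi (t * x))"
    by (intro integral_cong_AE) (measurable, use AE_indicator_\<Omega> in eventually_elim, simp add: scaleR_add_left)
  also have "\<dots> = endpoint_sum t / (2 * pi * \<i> * t)"
    unfolding endpoint_sum_def add_divide_distrib
    by (intro has_bochner_integral_integral_eq has_bochner_integral_add has_bochner_integral_expi assms)
      (use pq uv in auto)
  finally show ?thesis .
qed

lemma inner_expi:
  "L2_inner (restrict_space lborel \<Omega>) (\<lambda>x. expi (l * x)) (\<lambda>x. expi (m * x)) =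
    (if l = m then 1 else endpoint_sum (l - m) / (2 * pi * \<i> * (l - m)))"
proof -
  have eq: "expi (l * x) * cnj (expi (m * x)) = expi ((l - m) * x)" for x
    by (simp add: cnj_expi expi_add[symmetric] algebra_simps)
  show ?thesis
  proof (cases "l = m")
    case True
    have "measure (restrict_space lborel \<Omega>) \<Omega> = 1"
      by (simp add: measure_def emeasure_restrict_space emeasure_\<Omega>)
    then show ?thesis unfolding L2_inner_def eq using True by (simp add: space_restrict_space)
  next
    case False
    then show ?thesis unfolding L2_inner_def eq using integral_expi[of "l - m"] by simp
  qed
qed

lemma endpoint_sum_eq_0_iff:
  "endpoint_sum t = 0 \<longleftrightarrow>
    expi (t * (q - p)) + expi (t * ((u - p) + (v - u))) = 1 + expi (t * (u - p))"
proof -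
  have "endpoint_sum t = expi (t * p) *
    (expi (t * (q - p)) + expi (t * ((u - p) + (v - u))) - (1 + expi (t * (u - p))))"
    unfolding endpoint_sum_def by (simp add: expi_add[symmetric] algebra_simps)
  then show ?thesis by simp
qed

end

section \<open>A spectrum forces commensurability\<close>

text \<open>
  If \<open>g\<close> is orthogonal to a finite combination \<open>h\<close>, then
  \<open>\<parallel>g\<parallel>\<^sup>2 \<le> \<parallel>g\<parallel>\<^sup>2 + \<parallel>h\<parallel>\<^sup>2 = \<parallel>g - h\<parallel>\<^sup>2\<close>, and the right-hand side can be made arbitrarily small.
\<close>
lemma L2_orthonormal_basis_complete:
  assumes basis: "L2_orthonormal_basis M e" and g: "square_integrable M g"
    and orth: "\<And>i. L2_inner M g (e i) = 0"
  shows "AE x in M. g x = 0"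
proof -
  have [measurable]: "g \<in> borel_measurable M" "\<And>i. e i \<in> borel_measurable M"
    using assms unfolding L2_orthonormal_basis_def square_integrable_def by auto
  have int_g: "integrable M (\<lambda>x. (cmod (g x))\<^sup>2)" using g unfolding square_integrable_def by auto
  have int_e: "integrable M (\<lambda>x. (cmod (e i x))\<^sup>2)" for i
    using basis unfolding L2_orthonormal_basis_def square_integrable_def by auto
  have [measurable]: "cnj \<in> borel_measurable borel"
    by (intro borel_measurable_continuous_onI continuous_intros)
  have int_prod: "integrable M (\<lambda>x. g x * cnj (e i x))" for i
  proof (rule Bochner_Integration.integrable_bound[OF Bochner_Integration.integrable_add[OF int_g int_e[of i]]])
    have "a * b \<le> a\<^sup>2 + b\<^sup>2" for a b :: real
      using sum_squares_bound[of a b] zero_le_power2[of a] zero_le_power2[of b] by linarith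
    then show "AE x in M. cmod (g x * cnj (e i x)) \<le> norm ((cmod (g x))\<^sup>2 + (cmod (e i x))\<^sup>2)"
      by (simp add: norm_mult)
  qed measurable
  have small: "(LINT x|M. (cmod (g x))\<^sup>2) \<le> \<epsilon>\<^sup>2" if "\<epsilon> > 0" for \<epsilon>
  proof -
    obtain F c where F: "finite F" "L2_norm M (\<lambda>x. g x - (\<Sum>i\<in>F. c i * e i x)) < \<epsilon>"
      using basis g \<open>\<epsilon> > 0\<close> unfolding L2_orthonormal_basis_def by blast
    define h where "h = (\<lambda>x. \<Sum>i\<in>F. c i * e i x)"
    have [measurable]: "h \<in> borel_measurable M" unfolding h_def by measurable
    have gh_sum: "(\<lambda>x. g x * cnj (h x)) = (\<lambda>x. \<Sum>i\<in>F. cnj (c i) * (g x * cnj (e i x)))"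
      unfolding h_def by (simp add: sum_distrib_left mult.left_commute)
    have int_gh: "integrable M (\<lambda>x. g x * cnj (h x))"
      unfolding gh_sum using int_prod by simp
    have "(LINT x|M. g x * cnj (h x)) = (LINT x|M. (\<Sum>i\<in>F. cnj (c i) * (g x * cnj (e i x))))"
      unfolding gh_sum ..
    also have "\<dots> = (\<Sum>i\<in>F. cnj (c i) * (LINT x|M. g x * cnj (e i x)))"
      using int_prod by (subst Bochner_Integration.integral_sum) auto
    also have "\<dots> = 0" using orth unfolding L2_inner_def by simp
    finally have gh: "(LINT x|M. g x * cnj (h x)) = 0" .
    have pt: "(cmod (g x - h x))\<^sup>2 = (cmod (g x))\<^sup>2 - 2 * Re (g x * cnj (h x)) + (cmod (h x))\<^sup>2" for x
      unfolding cmod_power2 by (simp add: power2_eq_square algebra_simps)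
    have int_h: "integrable M (\<lambda>x. (cmod (h x))\<^sup>2)"
    proof -
      have bound: "(cmod (h x))\<^sup>2 \<le> real (card F) * (\<Sum>i\<in>F. (cmod (c i))\<^sup>2 * (cmod (e i x))\<^sup>2)" for x
      proof -
        have "cmod (h x) \<le> (\<Sum>i\<in>F. cmod (c i * e i x))" unfolding h_def by (rule norm_sum)
        then have "(cmod (h x))\<^sup>2 \<le> (\<Sum>i\<in>F. cmod (c i * e i x))\<^sup>2" by (intro power_mono) auto
        also have "\<dots> \<le> (\<Sum>i\<in>F. (cmod (c i * e i x))\<^sup>2) * of_nat (card F)"
          by (rule sum_squared_le_sum_of_squares)
        finally show ?thesis by (simp add: norm_mult power_mult_distrib mult.commute)
      qed
      have "integrable M (\<lambda>x. real (card F) * (\<Sum>i\<in>F. (cmod (c i))\<^sup>2 * (cmod (e i x))\<^sup>2))"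
        using int_e by simp
      then show ?thesis
      proof (rule Bochner_Integration.integrable_bound)
        show "AE x in M. norm ((cmod (h x))\<^sup>2) \<le>
          norm (real (card F) * (\<Sum>i\<in>F. (cmod (c i))\<^sup>2 * (cmod (e i x))\<^sup>2))"
          using bound by (intro AE_I2) (simp add: abs_of_nonneg sum_nonneg)
      qed measurable
    qed
    have "(LINT x|M. (cmod (g x))\<^sup>2) \<le> (LINT x|M. (cmod (g x))\<^sup>2) + (LINT x|M. (cmod (h x))\<^sup>2)" by simp
    also have "\<dots> = (LINT x|M. (cmod (g x))\<^sup>2) - 2 * Re (LINT x|M. g x * cnj (h x)) + (LINT x|M. (cmod (h x))\<^sup>2)"
      by (simp add: gh)
    also have "\<dots> = (LINT x|M. (cmod (g x - h x))\<^sup>2)"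
      unfolding pt using int_g int_h int_gh integrable_Re[OF int_gh] by (simp del: times_complex.sel)
    also have "\<dots> = (L2_norm M (\<lambda>x. g x - h x))\<^sup>2" by (simp add: L2_norm_def)
    also have "\<dots> \<le> \<epsilon>\<^sup>2" using F(2) unfolding h_def by (intro power_mono) (auto simp: L2_norm_def)
    finally show ?thesis .
  qed
  have "(LINT x|M. (cmod (g x))\<^sup>2) \<le> 0"
  proof (rule ccontr)
    assume "\<not> ?thesis"
    then have pos: "(LINT x|M. (cmod (g x))\<^sup>2) > 0" by simp
    have "(LINT x|M. (cmod (g x))\<^sup>2) \<le> (sqrt ((LINT x|M. (cmod (g x))\<^sup>2) / 2))\<^sup>2"
      using pos by (intro small) simp
    then show False using pos by simp
  qed
  then have "(LINT x|M. (cmod (g x))\<^sup>2) = 0" by (simp add: antisym)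
  then show ?thesis using int_g by (subst (asm) integral_nonneg_eq_0_iff_AE) auto
qed

text \<open>
  For unimodular numbers, conjugating \<open>\<alpha> + \<beta> = 1 + \<gamma>\<close> divides the left side by \<open>\<alpha> \<beta>\<close> and the right
  side by \<open>\<gamma>\<close>. Unless the sums vanish, the pairs \<open>{\<alpha>, \<beta>}\<close> and \<open>{1, \<gamma>}\<close> thus have the same sum and
  the same product.
\<close>
lemma unit_sums_eq_cases:
  fixes \<alpha> \<beta> \<gamma> :: complex
  assumes unit: "cmod \<alpha> = 1" "cmod \<beta> = 1" "cmod \<gamma> = 1" and eq: "\<alpha> + \<beta> = 1 + \<gamma>"
  shows "\<alpha> = 1 \<and> \<beta> = \<gamma> \<or> \<alpha> = \<gamma> \<and> \<beta> = 1 \<or> \<beta> = - \<alpha> \<and> \<gamma> = - 1"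
proof (cases "1 + \<gamma> = 0")
  case True
  then show ?thesis using eq by (simp add: add_eq_0_iff)
next
  case False
  have inv: "z * cnj z = 1" if "cmod z = 1" for z using that by (simp add: complex_norm_square[symmetric])
  have "\<alpha> * \<beta> * cnj (1 + \<gamma>) = \<alpha> * \<beta> * cnj (\<alpha> + \<beta>)" by (simp add: eq)
  also have "\<dots> = (\<alpha> * cnj \<alpha>) * \<beta> + (\<beta> * cnj \<beta>) * \<alpha>" by (simp add: algebra_simps)
  also have "\<dots> = 1 + \<gamma>" using eq inv unit by (simp add: add.commute)
  also have "\<dots> = \<gamma> * cnj (1 + \<gamma>)" using inv[OF unit(3)] by (simp add: algebra_simps)
  finally have "\<alpha> * \<beta> = \<gamma>" using False by (metis complex_cnj_zero_iff mult_right_cancel)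
  then have "(\<alpha> - 1) * (\<alpha> - \<gamma>) = \<alpha> * (\<alpha> + \<beta> - 1 - \<gamma>)" by (simp add: algebra_simps)
  then have "\<alpha> = 1 \<or> \<alpha> = \<gamma>" using eq by simp
  then show ?thesis using eq by auto
qed

text \<open>
  A difference \<open>d = x1 - x0\<close> outside \<open>\<int>\<close> leaves only the third alternative of
  \<open>unit_sums_eq_cases\<close>: \<open>e(d a) = - 1\<close> and \<open>e(d (a + s)) = - w\<close> with \<open>w = e(d r)\<close>, where
  \<open>w\<^sup>2 \<noteq> 1\<close>. For any other frequency \<open>x\<close>, the three alternatives for \<open>x - x0\<close> are compared with
  those for \<open>x - x1\<close>; because \<open>w\<^sup>2 \<noteq> 1\<close>, every consistent combination says that \<open>x\<close> belongs to the class of \<open>x0\<close> or to that of \<open>x1\<close>.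
\<close>
lemma frequencies_in_two_classes:
  fixes L :: "real set" and r s a :: real
  assumes sum: "r + s = 1" and x0: "x0 \<in> L"
    and gram: "\<And>x y. x \<in> L \<Longrightarrow> y \<in> L \<Longrightarrow>
      expi ((x - y) * r) + expi ((x - y) * (a + s)) = 1 + expi ((x - y) * a)"
  shows "(\<forall>x\<in>L. x - x0 \<in> \<int>) \<or>
    (\<exists>x1\<in>L. \<forall>x\<in>L. \<exists>y\<in>{x0, x1}. (x - y) * r \<in> \<int> \<and> (x - y) * s \<in> \<int> \<and> (x - y) * a \<in> \<int>)"
proof (rule disjCI)
  assume "\<not> (\<exists>x1\<in>L. \<forall>x\<in>L. \<exists>y\<in>{x0, x1}. (x - y) * r \<in> \<int> \<and> (x - y) * s \<in> \<int> \<and> (x - y) * a \<in> \<int>)"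
    (is "\<not> ?two")
  moreover have ?two if "\<not> (\<forall>x\<in>L. x - x0 \<in> \<int>)"
  proof -
    from that obtain x1 where x1: "x1 \<in> L" and nonint: "x1 - x0 \<notin> \<int>" by blast
    define d where "d = x1 - x0"
    have split: "d = d * r + d * s" using sum by (metis distrib_left mult.right_neutral)
    have eqs: "(x - y) * s = (x - y) * (a + s) - (x - y) * a" for x y by (simp add: algebra_simps)
    have a_s: "expi (t * (a + s)) = expi (t * a) * expi (t * s)" for t
      by (simp add: expi_add[symmetric] algebra_simps)
    define w where "w = expi (d * r)"
    have "\<not> (expi (d * r) = 1 \<and> expi (d * s) = 1)"
      using nonint Ints_add[of "d * r" "d * s"] split unfolding expi_eq_1_iff d_def by metis
    moreover have "expi (d * r) * expi (d * s) \<noteq> 1"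
      using nonint by (simp only: expi_add[symmetric] split[symmetric] expi_eq_1_iff d_def[symmetric] not_False_eq_True)
    moreover have "expi (d * r) = 1 \<and> expi (d * (a + s)) = expi (d * a) \<or>
      expi (d * r) = expi (d * a) \<and> expi (d * (a + s)) = 1 \<or>
      expi (d * (a + s)) = - expi (d * r) \<and> expi (d * a) = - 1"
      using gram[OF x1 x0] unfolding d_def by (intro unit_sums_eq_cases) auto
    ultimately have d: "expi (d * (a + s)) = - w" "expi (d * a) = - 1" and "w \<noteq> 1" "w \<noteq> - 1"
      unfolding w_def a_s by auto
    then have w: "w * w \<noteq> 1" "w \<noteq> 1" "- w \<noteq> 1" by (auto simp: square_eq_1_iff minus_equation_iff)
    have w0: "w \<noteq> 0" by (simp add: w_def)
    have "\<exists>y\<in>{x0, x1}. (x - y) * r \<in> \<int> \<and> (x - y) * s \<in> \<int> \<and> (x - y) * a \<in> \<int>" if x: "x \<in> L" for x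
    proof -
      define A B y where "A = expi ((x - x0) * r)" and "B = expi ((x - x0) * (a + s))"
        and "y = expi ((x - x0) * a)"
      have sub: "(x - x1) * c = (x - x0) * c - d * c" for c by (simp add: d_def algebra_simps)
      have t1: "expi ((x - x1) * r) = A / w" "expi ((x - x1) * (a + s)) = - B / w"
        "expi ((x - x1) * a) = - y"
        unfolding sub expi_diff d w_def[symmetric] A_def B_def y_def by auto
      have first: "A = 1 \<and> B = y \<or> A = y \<and> B = 1 \<or> B = - A \<and> y = - 1"
        using gram[OF x x0] unfolding A_def B_def y_def by (intro unit_sums_eq_cases) auto
      have "A / w = 1 \<and> - B / w = - y \<or> A / w = - y \<and> - B / w = 1 \<or> - B / w = - (A / w) \<and> - y = - 1"
        using gram[OF x x1] unfolding t1[symmetric] by (intro unit_sums_eq_cases) auto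
      then have second: "A = w \<and> B = y * w \<or> A = - (y * w) \<and> B = - w \<or> B = A \<and> y = 1"
        using w0 by (auto simp: field_simps)
      have "(A = 1 \<and> B = 1 \<and> y = 1) \<or> (A = w \<and> B = - w \<and> y = - 1)"
        using first
      proof (elim disjE conjE)
        assume "A = 1" "B = y"
        then show ?thesis using second w
          by (elim disjE conjE) (simp_all, metis minus_minus mult_minus_left)
      next
        assume "A = y" "B = 1"
        then show ?thesis using second w by metis
      next
        assume "B = - A" "y = - 1"
        then show ?thesis using second w by (elim disjE conjE) simp_all
      qed
      then show ?thesis
      proof
        assume "A = 1 \<and> B = 1 \<and> y = 1"
        then show ?thesis
          unfolding A_def B_def y_def expi_eq_1_iff by (metis eqs Ints_diff insertI1)
      next
        assume "A = w \<and> B = - w \<and> y = - 1"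
        then have "expi ((x - x1) * r) = 1" "expi ((x - x1) * (a + s)) = 1" "expi ((x - x1) * a) = 1"
          unfolding t1 using w0 by auto
        then show ?thesis
          unfolding expi_eq_1_iff by (metis eqs Ints_diff insertI1 insertI2)
      qed
    qed
    then show ?thesis using x1 by blast
  qed
  ultimately show "\<forall>x\<in>L. x - x0 \<in> \<int>" by blast
qed

text \<open>
  The vector product of \<open>U\<close> and \<open>V\<close>, or, if its last component vanishes, a solution supported on the
  first two coordinates.
\<close>
lemma two_equations_in_three_unknowns:
  fixes U V :: "nat \<Rightarrow> complex"
  assumes "U 0 \<noteq> 0"
  shows "\<exists>\<alpha>. (\<exists>i<3. \<alpha> i \<noteq> 0) \<and> (\<Sum>i<3. \<alpha> i * U i) = 0 \<and> (\<Sum>i<3. \<alpha> i * V i) = 0"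
proof (cases "U 0 * V 1 = U 1 * V 0")
  case True
  define \<alpha> where "\<alpha> i = (if i = 0 then U 1 else if i = 1 then - U 0 else 0)" for i :: nat
  show ?thesis
  proof (intro exI conjI)
    show "1 < (3::nat)" by simp
    show "\<alpha> 1 \<noteq> 0" using assms by (simp add: \<alpha>_def)
    show "(\<Sum>i<3. \<alpha> i * U i) = 0" by (simp add: \<alpha>_def eval_nat_numeral)
    show "(\<Sum>i<3. \<alpha> i * V i) = 0" using True by (simp add: \<alpha>_def eval_nat_numeral)
  qed
next
  case False
  define \<alpha> where "\<alpha> i = (if i = 0 then U 1 * V 2 - U 2 * V 1
    else if i = 1 then U 2 * V 0 - U 0 * V 2 else U 0 * V 1 - U 1 * V 0)" for i :: nat
  show ?thesis
  proof (intro exI conjI)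
    show "2 < (3::nat)" by simp
    show "\<alpha> 2 \<noteq> 0" using False by (simp add: \<alpha>_def)
    show "(\<Sum>i<3. \<alpha> i * U i) = 0" "(\<Sum>i<3. \<alpha> i * V i) = 0"
      by (simp_all add: \<alpha>_def eval_nat_numeral algebra_simps)
  qed
qed

context two_intervals
begin

text \<open>
  The step function with value \<open>\<alpha> i\<close> on the cell at \<open>c i\<close> has inner product
  \<open>(\<Sum>i. \<alpha> i * e(- l k * c i)) * \<integral>\<^bsub>(0, \<delta>)\<^esub> e(- l k * x) dx\<close> with the exponential of frequency \<open>l k\<close>. If
  these all vanish, so does the step function, by completeness.
\<close>
lemma separated_cells_independent:
  fixes l :: "'i \<Rightarrow> real" and \<alpha> :: "nat \<Rightarrow> complex" and c :: "nat \<Rightarrow> real"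
  assumes basis: "L2_orthonormal_basis (restrict_space lborel \<Omega>) (\<lambda>k x. expi (l k * x))"
    and fin: "finite F" and \<delta>: "0 < \<delta>"
    and cells: "\<And>i. i \<in> F \<Longrightarrow> {c i<..<c i + \<delta>} \<subseteq> \<Omega>"
    and disj: "\<And>i j. i \<in> F \<Longrightarrow> j \<in> F \<Longrightarrow> i \<noteq> j \<Longrightarrow> c i + \<delta> \<le> c j \<or> c j + \<delta> \<le> c i"
    and annih: "\<And>k. (\<Sum>i\<in>F. \<alpha> i * expi (- (l k * c i))) = 0"
    and i: "i \<in> F"
  shows "\<alpha> i = 0"
proof -
  let ?M = "restrict_space lborel \<Omega>"
  define cell where "cell i = {c i<..<c i + \<delta>}" for i
  have [measurable]: "cell i \<in> sets borel" for i by (simp add: cell_def)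
  define g where "g = (\<lambda>x. \<Sum>i\<in>F. \<alpha> i * indicator (cell i) x)"
  have [measurable]: "g \<in> borel_measurable borel" unfolding g_def by measurable
  have g_cell: "g x = \<alpha> j" if "j \<in> F" "x \<in> cell j" for x j
  proof -
    have "indicator (cell i) x = (if i = j then 1 else (0::complex))" if "i \<in> F" for i
      using disj[OF that \<open>j \<in> F\<close>] \<open>x \<in> cell j\<close> by (auto simp: cell_def indicator_def)
    then have "g x = (\<Sum>i\<in>F. \<alpha> i * (if i = j then 1 else 0))" unfolding g_def by (intro sum.cong) auto
    then show ?thesis using fin \<open>j \<in> F\<close> by (simp add: if_distrib[of "(*) _"] cong: if_cong)
  qed
  have "finite_measure ?M"
    by (rule finite_measureI) (simp add: space_restrict_space emeasure_restrict_space emeasure_\<Omega>)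
  then interpret finite_measure ?M .
  have g_M [measurable]: "g \<in> borel_measurable ?M"
    by (rule measurable_restrict_space1) measurable
  have "square_integrable ?M g"
    unfolding square_integrable_def
  proof
    have "cmod (g x) \<le> (\<Sum>i\<in>F. cmod (\<alpha> i))" for x
      unfolding g_def by (rule sum_norm_le) (auto simp: indicator_def norm_mult)
    then have "(cmod (g x))\<^sup>2 \<le> (\<Sum>i\<in>F. cmod (\<alpha> i))\<^sup>2" for x by (intro power_mono) auto
    then show "integrable ?M (\<lambda>x. (cmod (g x))\<^sup>2)"
      by (intro integrable_const_bound[of _ "(\<Sum>i\<in>F. cmod (\<alpha> i))\<^sup>2"]) auto
  qed (rule g_M)
  moreover have "L2_inner ?M g (\<lambda>x. expi (l k * x)) = 0" for k
  proof -
    define I where "I = (LINT x|lborel. indicator {0<..<\<delta>} x *\<^sub>R expi (- (l k * x)))"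
    have integrable: "integrable lborel (\<lambda>x. indicator (cell i) x *\<^sub>R expi (- (l k * x)))" for i
    proof (rule Bochner_Integration.integrable_bound)
      show "integrable lborel (indicator (cell i) :: real \<Rightarrow> real)"
        using \<delta> by (intro integrable_real_indicator) (simp_all add: cell_def)
    qed (auto simp: indicator_def)
    have shift: "(LINT x|lborel. indicator (cell i) x *\<^sub>R expi (- (l k * x))) = expi (- (l k * c i)) * I" for i
    proof -
      have "(LINT x|lborel. indicator (cell i) x *\<^sub>R expi (- (l k * x))) =
        (LINT x|lborel. indicator (cell i) (c i + 1 * x) *\<^sub>R expi (- (l k * (c i + 1 * x))))"
        by (subst lborel_integral_real_affine[of 1 _ "c i"]) simp_all
      also have "\<dots> = (LINT x|lborel. expi (- (l k * c i)) * (indicator {0<..<\<delta>} x *\<^sub>R expi (- (l k * x))))"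
        by (intro Bochner_Integration.integral_cong)
          (auto simp: cell_def indicator_def expi_add[symmetric] algebra_simps)
      finally show ?thesis unfolding I_def integral_mult_right_zero .
    qed
    have "L2_inner ?M g (\<lambda>x. expi (l k * x)) = (LINT x|lborel. indicator \<Omega> x *\<^sub>R (g x * expi (- (l k * x))))"
      unfolding L2_inner_def cnj_expi by (rule integral_restrict_space) simp
    also have "\<dots> = (LINT x|lborel. (\<Sum>i\<in>F. \<alpha> i * (indicator (cell i) x *\<^sub>R expi (- (l k * x)))))"
    proof (intro Bochner_Integration.integral_cong refl)
      fix x
      have "indicator \<Omega> x *\<^sub>R (\<alpha> i * indicator (cell i) x * expi (- (l k * x))) =
        \<alpha> i * (indicator (cell i) x *\<^sub>R expi (- (l k * x)))" if "i \<in> F" for i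
        using cells[OF that] by (auto simp: cell_def indicator_def)
      then show "indicator \<Omega> x *\<^sub>R (g x * expi (- (l k * x))) =
        (\<Sum>i\<in>F. \<alpha> i * (indicator (cell i) x *\<^sub>R expi (- (l k * x))))"
        unfolding g_def sum_distrib_right scaleR_sum_right by (intro sum.cong) auto
    qed
    also have "\<dots> = (\<Sum>i\<in>F. \<alpha> i * (expi (- (l k * c i)) * I))"
      by (subst Bochner_Integration.integral_sum)
        (simp_all only: integrable integrable_mult_right integral_mult_right_zero shift)
    also have "\<dots> = (\<Sum>i\<in>F. \<alpha> i * expi (- (l k * c i))) * I" by (simp add: sum_distrib_right mult.assoc)
    finally show ?thesis using annih by simp
  qed
  ultimately have "AE x in ?M. g x = 0" by (rule L2_orthonormal_basis_complete[OF basis])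
  then have AE: "AE x in lborel. x \<in> \<Omega> \<longrightarrow> g x = 0" by (simp add: AE_restrict_space_iff)
  show ?thesis
  proof (rule ccontr)
    assume "\<alpha> i \<noteq> 0"
    have "AE x in lborel. x \<notin> cell i"
      using AE
    proof (rule AE_mp, intro AE_I2 impI notI)
      fix x assume x: "x \<in> \<Omega> \<longrightarrow> g x = 0" "x \<in> cell i"
      have "x \<in> \<Omega>" using cells[OF i] x(2) unfolding cell_def by (rule subsetD)
      with x g_cell[OF i x(2)] \<open>\<alpha> i \<noteq> 0\<close> show False by simp
    qed
    then have "cell i \<in> null_sets lborel" using AE_iff_null_sets[of "cell i" lborel] by simp
    then have "emeasure lborel (cell i) = 0" by (rule null_setsD1)
    then show False using \<delta> unfolding cell_def by simp
  qed
qed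

text \<open>
  Up to a factor, the vector of the values of an exponential at three points depends only on its class, so
  there are just two linear conditions on the coefficients in \<open>separated_cells_independent\<close>.
\<close>
lemma no_three_cells_for_two_classes:
  fixes l :: "'i \<Rightarrow> real" and c :: "nat \<Rightarrow> real"
  assumes basis: "L2_orthonormal_basis (restrict_space lborel \<Omega>) (\<lambda>k x. expi (l k * x))"
    and \<delta>: "0 < \<delta>"
    and cells: "\<And>i. i < 3 \<Longrightarrow> {c i<..<c i + \<delta>} \<subseteq> \<Omega>"
    and disj: "\<And>i j. i < 3 \<Longrightarrow> j < 3 \<Longrightarrow> i \<noteq> j \<Longrightarrow> c i + \<delta> \<le> c j \<or> c j + \<delta> \<le> c i"
    and classes: "\<And>k. \<exists>j\<in>{x0, x1}. \<forall>i<3. (l k - j) * (c i - p) \<in> \<int>"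
  shows False
proof -
  define U V where "U i = expi (- (x0 * (c i - p)))" and "V i = expi (- (x1 * (c i - p)))" for i
  have "U 0 \<noteq> 0" unfolding U_def by (rule expi_neq_0)
  from two_equations_in_three_unknowns[of U V, OF this]
  obtain \<alpha> n where \<alpha>: "n < 3" "\<alpha> n \<noteq> 0"
    "(\<Sum>i<3. \<alpha> i * expi (- (x0 * (c i - p)))) = 0" "(\<Sum>i<3. \<alpha> i * expi (- (x1 * (c i - p)))) = 0"
    unfolding U_def V_def by blast
  have "(\<Sum>i<3. \<alpha> i * expi (- (l k * c i))) = 0" for k
  proof -
    obtain j where j: "j \<in> {x0, x1}" "\<And>i. i < 3 \<Longrightarrow> (l k - j) * (c i - p) \<in> \<int>" using classes by blast
    have "expi (- (l k * c i)) = expi (- (l k * p)) * expi (- (j * (c i - p)))" if "i < 3" for i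
      using Ints_minus[OF j(2)[OF that]] unfolding expi_add[symmetric] expi_eq_iff
      by (simp add: algebra_simps)
    then have "(\<Sum>i<3. \<alpha> i * expi (- (l k * c i))) =
      expi (- (l k * p)) * (\<Sum>i<3. \<alpha> i * expi (- (j * (c i - p))))"
      unfolding sum_distrib_left by (intro sum.cong) auto
    then show ?thesis using j(1) \<alpha> by auto
  qed
  then have "\<alpha> n = 0"
    using separated_cells_independent[OF basis, of "{..<3}" \<delta> c \<alpha> n] \<delta> cells disj \<alpha>(1) by auto
  then show False using \<alpha>(2) by simp
qed

text \<open>
  It remains to exhibit the cells. In the integral case, if the gap lies strictly between
  \<open>n - 1\<close> and \<open>n\<close>, then \<open>(p, q)\<close> and \<open>(u - n, v - n)\<close> overlap, because their lengths add up to
  \<open>1\<close>, and a cell is their intersection. In the case of two classes, with offsets measured from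
  \<open>p\<close>: \<open>0, a, a + r\<close> if the second interval is longer, \<open>0, s, a\<close> if the first one is, and
  \<open>0, a - k/2, a\<close> with \<open>k = \<lfloor>2 a\<rfloor>\<close> if both have length \<open>1/2\<close>.
\<close>
lemma commensurable_if_spectrum:
  assumes "has_spectrum \<Omega>"
  shows commensurable
proof -
  obtain l :: "int \<Rightarrow> real" where inj: "inj l"
    and basis: "L2_orthonormal_basis (restrict_space lborel \<Omega>) (\<lambda>k x. expi (l k * x))"
    using assms unfolding has_spectrum_def is_spectrum_def exp_eq_expi by blast
  define r s a where "r = q - p" and "s = v - u" and "a = u - p"
  have rsa: "0 < r" "0 < s" "r + s = 1" "r \<le> a" "q = p + r" "u = p + a" "v = p + a + s"
    using pq uv qu total_length by (auto simp: r_def s_def a_def)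
  have "endpoint_sum (l i - l j) = 0" if "i \<noteq> j" for i j
  proof -
    have "L2_inner (restrict_space lborel \<Omega>) (\<lambda>x. expi (l i * x)) (\<lambda>x. expi (l j * x)) = 0"
      using basis that unfolding L2_orthonormal_basis_def by auto
    moreover have "l i \<noteq> l j" using inj that by (auto dest: injD)
    ultimately show ?thesis unfolding inner_expi by auto
  qed
  then have gram: "expi ((l i - l j) * r) + expi ((l i - l j) * (a + s)) = 1 + expi ((l i - l j) * a)" for i j
    by (cases "i = j") (simp_all add: r_def s_def a_def endpoint_sum_eq_0_iff)
  have "(\<forall>x\<in>range l. x - l 0 \<in> \<int>) \<or>
    (\<exists>x1\<in>range l. \<forall>x\<in>range l. \<exists>y\<in>{l 0, x1}. (x - y) * r \<in> \<int> \<and> (x - y) * s \<in> \<int> \<and> (x - y) * a \<in> \<int>)"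
    using gram rsa by (intro frequencies_in_two_classes) auto
  then show ?thesis
  proof
    assume int: "\<forall>x\<in>range l. x - l 0 \<in> \<int>"
    show ?thesis
    proof (rule ccontr)
      assume "\<not> commensurable"
      then have "u - q \<notin> \<int>" unfolding commensurable_def by simp
      define n where "n = \<lfloor>u - q\<rfloor> + 1"
      have n: "of_int n - 1 < u - q" "u - q < of_int n"
      proof -
        have "of_int \<lfloor>u - q\<rfloor> \<noteq> u - q" using \<open>u - q \<notin> \<int>\<close> by (metis Ints_of_int)
        then show "of_int n - 1 < u - q" "u - q < of_int n" unfolding n_def by linarith+
      qed
      \<comment> \<open>The cell \<open>(b, b + \<delta>)\<close> is the intersection of \<open>(p, q)\<close> and \<open>(u - n, v - n)\<close>.\<close>
      define b \<delta> where "b = max p (u - n)" and "\<delta> = min q (v - n) - b"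
      have "0 < \<delta>" unfolding b_def \<delta>_def using n pq uv total_length by auto
      define c where "c i = b + (if i = 0 then 0 else of_int n)" for i :: nat
      \<comment> \<open>All exponentials change by the same factor \<open>e(l 0 * n)\<close> under translation by \<open>n\<close>.\<close>
      define \<alpha> where "\<alpha> i = (if i = 0 then 1 else - 1) * expi (l 0 * c i)" for i
      have "\<alpha> 0 = 0"
      proof (rule separated_cells_independent[OF basis _ \<open>0 < \<delta>\<close>, of "{0, 1}" c])
        have "{c 0<..<c 0 + \<delta>} \<subseteq> {p<..<q}" "{c 1<..<c 1 + \<delta>} \<subseteq> {u<..<v}"
          unfolding c_def b_def \<delta>_def by auto
        then show "{c i<..<c i + \<delta>} \<subseteq> \<Omega>" if "i \<in> {0, 1}" for i using that inner by auto
        have "c 0 + \<delta> \<le> c 1" unfolding c_def b_def \<delta>_def using qu by auto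
        then show "c i + \<delta> \<le> c j \<or> c j + \<delta> \<le> c i" if "i \<in> {0, 1}" "j \<in> {0, 1}" "i \<noteq> j" for i j
          using that by auto
        show "(\<Sum>i\<in>{0, 1}. \<alpha> i * expi (- (l k * c i))) = 0" for k
        proof -
          have "(l k - l 0) * of_int n \<in> \<int>" using int by auto
          then have "expi (l 0 * c 0 + - (l k * c 0)) = expi (l 0 * c 1 + - (l k * c 1))"
            unfolding expi_eq_iff c_def by (simp add: algebra_simps)
          then show ?thesis unfolding \<alpha>_def by (simp add: expi_add[symmetric])
        qed
      qed auto
      then show False unfolding \<alpha>_def by simp
    qed
  next
    assume "\<exists>x1\<in>range l. \<forall>x\<in>range l. \<exists>y\<in>{l 0, x1}.
      (x - y) * r \<in> \<int> \<and> (x - y) * s \<in> \<int> \<and> (x - y) * a \<in> \<int>"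
    then obtain x1 where classes: "\<And>k. \<exists>y\<in>{l 0, x1}.
      (l k - y) * r \<in> \<int> \<and> (l k - y) * s \<in> \<int> \<and> (l k - y) * a \<in> \<int>" by blast
    \<comment> \<open>The three cells are at offsets \<open>0\<close>, \<open>b\<close> and \<open>d\<close> from \<open>p\<close>.\<close>
    have three: False
      if \<delta>: "0 < \<delta>" "\<delta> \<le> r" and disj: "\<delta> \<le> b" "b + \<delta> \<le> d"
        and cells: "b + \<delta> \<le> r \<or> a \<le> b \<and> b + \<delta> \<le> a + s" "a \<le> d" "d + \<delta> \<le> a + s"
        and lattice: "\<And>t. t * r \<in> \<int> \<Longrightarrow> t * s \<in> \<int> \<Longrightarrow> t * a \<in> \<int> \<Longrightarrow> t * b \<in> \<int> \<and> t * d \<in> \<int>"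
      for \<delta> b d :: real
    proof -
      define c where "c i = p + (if i = 0 then 0 else if i = 1 then b else d)" for i :: nat
      have c: "c 0 = p" "c 1 = p + b" "c 2 = p + d" by (simp_all add: c_def)
      have below_3: "i = 0 \<or> i = 1 \<or> i = 2" if "i < 3" for i :: nat using that by linarith
      show False
      proof (rule no_three_cells_for_two_classes[OF basis \<delta>(1), of c "l 0" x1])
        have "{c 0<..<c 0 + \<delta>} \<subseteq> {p<..<q}" "{c 2<..<c 2 + \<delta>} \<subseteq> {u<..<v}"
          "{c 1<..<c 1 + \<delta>} \<subseteq> {p<..<q} \<or> {c 1<..<c 1 + \<delta>} \<subseteq> {u<..<v}"
          unfolding c using \<delta> disj cells rsa by auto
        then show "{c i<..<c i + \<delta>} \<subseteq> \<Omega>" if "i < 3" for i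
          using below_3[OF that] inner by auto
        have "c 0 + \<delta> \<le> c 1" "c 1 + \<delta> \<le> c 2" "c 0 + \<delta> \<le> c 2" unfolding c using disj \<delta>(1) by auto
        then show "c i + \<delta> \<le> c j \<or> c j + \<delta> \<le> c i" if "i < 3" "j < 3" "i \<noteq> j" for i j
          using below_3[OF that(1)] below_3[OF that(2)] that(3) by auto
        show "\<exists>j\<in>{l 0, x1}. \<forall>i<3. (l k - j) * (c i - p) \<in> \<int>" for k
        proof -
          obtain y where y: "y \<in> {l 0, x1}"
            "(l k - y) * r \<in> \<int>" "(l k - y) * s \<in> \<int>" "(l k - y) * a \<in> \<int>" using classes by blast
          have "(l k - y) * (c i - p) \<in> \<int>" if "i < 3" for i
            using below_3[OF that] lattice[OF y(2-4)] by (auto simp: c_def)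
          then show ?thesis using y(1) by blast
        qed
      qed
    qed
    consider "r < s" | "s < r" | "r = s" by linarith
    then show ?thesis
    proof cases
      case 1
      define \<delta> where "\<delta> = min r (s - r)"
      have \<delta>: "0 < \<delta>" "\<delta> \<le> r" "r + \<delta> \<le> s" using 1 rsa unfolding \<delta>_def by auto
      have False
      proof (rule three)
        show "0 < \<delta>" "\<delta> \<le> r" by (fact \<delta>)+
        show "\<delta> \<le> a" "a + \<delta> \<le> a + r" "a \<le> a + r" "a + r + \<delta> \<le> a + s" using \<delta> rsa by linarith+
        show "a + \<delta> \<le> r \<or> a \<le> a \<and> a + \<delta> \<le> a + s" using \<delta> rsa by linarith
      qed (simp add: distrib_left)
      then show ?thesis ..
    next
      case 2
      define \<delta> where "\<delta> = min s (r - s)"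
      have \<delta>: "0 < \<delta>" "\<delta> \<le> s" "s + \<delta> \<le> r" using 2 rsa unfolding \<delta>_def by auto
      have False
      proof (rule three)
        show "0 < \<delta>" "\<delta> \<le> s" by (fact \<delta>)+
        show "\<delta> \<le> r" "s + \<delta> \<le> a" "a \<le> a" "a + \<delta> \<le> a + s" using \<delta> rsa by linarith+
        show "s + \<delta> \<le> r \<or> a \<le> s \<and> s + \<delta> \<le> a + s" using \<delta> by linarith
      qed simp
      then show ?thesis ..
    next
      case 3
      then have half: "r = 1/2" "s = 1/2" using rsa by auto
      show ?thesis
      proof (rule ccontr)
        assume "\<not> commensurable"
        then have "2 * a \<notin> \<int>" using half unfolding commensurable_def r_def a_def by auto
        define k where "k = \<lfloor>2 * a\<rfloor>"
        have "of_int k \<noteq> 2 * a" using \<open>2 * a \<notin> \<int>\<close> by (metis Ints_of_int)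
        then have k: "of_int k < 2 * a" "2 * a < of_int k + 1" unfolding k_def by linarith+
        define b where "b = a - of_int k / 2"
        have b: "0 < b" "b < 1/2" using k unfolding b_def by (simp_all add: field_simps)
        have lattice: "t * b \<in> \<int>" if "t * r \<in> \<int>" "t * a \<in> \<int>" for t
        proof -
          have "t * b = t * a - of_int k * (t * r)" using half unfolding b_def by (simp add: algebra_simps)
          then show ?thesis using that by simp
        qed
        define \<delta> where "\<delta> = min b (1/2 - b)"
        have \<delta>: "0 < \<delta>" "\<delta> \<le> b" "b + \<delta> \<le> 1/2" using b unfolding \<delta>_def by (auto simp: min_def)
        show False
        proof (rule three)
          show "0 < \<delta>" "\<delta> \<le> b" by (fact \<delta>)+
          show "\<delta> \<le> r" "b + \<delta> \<le> a" "a \<le> a" "a + \<delta> \<le> a + s" using \<delta> b rsa half by linarith+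
          show "b + \<delta> \<le> r \<or> a \<le> b \<and> b + \<delta> \<le> a + s" using \<delta> half by linarith
        qed (use lattice in blast)
      qed
    qed
  qed
qed

end

section \<open>Density of trigonometric polynomials\<close>

text \<open>
  Finite linear combinations of exponentials, generated one term at a time so that closure
  properties follow by induction, with no bookkeeping of coefficient families.
\<close>
inductive_set expspan :: "real set \<Rightarrow> (real \<Rightarrow> complex) set" for L where
  zero: "(\<lambda>x. 0) \<in> expspan L"
| add_term: "g \<in> expspan L \<Longrightarrow> l \<in> L \<Longrightarrow> (\<lambda>x. g x + c * expi (l * x)) \<in> expspan L"

lemma expspan_term: "l \<in> L \<Longrightarrow> (\<lambda>x. c * expi (l * x)) \<in> expspan L"
  using expspan.add_term[OF expspan.zero, of l L c] by simp

lemma expspan_add: "f \<in> expspan L \<Longrightarrow> g \<in> expspan L \<Longrightarrow> (\<lambda>x. f x + g x) \<in> expspan L"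
proof (induction rule: expspan.induct)
  case (add_term f l c)
  then have "(\<lambda>x. (f x + g x) + c * expi (l * x)) \<in> expspan L" by (intro expspan.add_term)
  then show ?case by (simp add: algebra_simps)
qed simp

lemma expspan_mult_expi:
  assumes "f \<in> expspan L" and "\<And>l. l \<in> L \<Longrightarrow> l + m \<in> L'"
  shows "(\<lambda>x. f x * (c * expi (m * x))) \<in> expspan L'"
  using assms(1)
proof induction
  case zero
  then show ?case by (simp add: expspan.zero)
next
  case (add_term f l d)
  then have "(\<lambda>x. f x * (c * expi (m * x)) + (d * c) * expi ((l + m) * x)) \<in> expspan L'"
    using assms(2) by (intro expspan.add_term)
  then show ?case by (simp add: algebra_simps expi_add)
qed

lemma expspan_mult:
  assumes "f \<in> expspan L" "g \<in> expspan L" and closed: "\<And>l m. l \<in> L \<Longrightarrow> m \<in> L \<Longrightarrow> l + m \<in> L"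
  shows "(\<lambda>x. f x * g x) \<in> expspan L"
  using assms(2)
proof induction
  case zero
  then show ?case by (simp add: expspan.zero)
next
  case (add_term g l c)
  then have "(\<lambda>x. f x * g x + f x * (c * expi (l * x))) \<in> expspan L"
    using assms(1) closed by (intro expspan_add expspan_mult_expi[where L = L]) auto
  then show ?case by (simp add: algebra_simps)
qed

lemma expspan_scale: "f \<in> expspan L \<Longrightarrow> (\<lambda>x. c * f x) \<in> expspan L"
  using expspan_mult_expi[of f L 0 L c] by (simp add: mult.commute)

lemma expspan_mono: "f \<in> expspan L \<Longrightarrow> L \<subseteq> L' \<Longrightarrow> f \<in> expspan L'"
  using expspan_mult_expi[of f L 0 L' 1] by auto

lemma expspan_measurable: "f \<in> expspan L \<Longrightarrow> f \<in> borel_measurable borel"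
proof (induction rule: expspan.induct)
  case (add_term g l c)
  have "(\<lambda>x. c * expi (l * x)) \<in> borel_measurable borel"
    by (intro borel_measurable_continuous_onI continuous_intros)
  with add_term show ?case by measurable
qed simp

lemma expspan_shift:
  assumes "f \<in> expspan L" and "\<And>l. l \<in> L \<Longrightarrow> l * t \<in> \<int>"
  shows "f (x + t) = f x"
  using assms(1)
proof induction
  case (add_term g l c)
  have "expi (l * (x + t)) = expi (l * x)"
    using assms(2)[OF add_term.hyps(2)] unfolding expi_eq_iff by (simp add: algebra_simps)
  then show ?case using add_term.IH by simp
qed simp

lemma expspan_range_eq_sum:
  assumes "g \<in> expspan (range l)"
  shows "\<exists>F c. finite F \<and> g = (\<lambda>x. \<Sum>i\<in>F. c i * expi (l i * x))"
  using assms
proof induction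
  case zero
  then show ?case by (intro exI[of _ "{}"]) auto
next
  case (add_term g m d)
  then obtain F c i where F: "finite F" "g = (\<lambda>x. \<Sum>i\<in>F. c i * expi (l i * x))" and m: "m = l i" by blast
  define c' where "c' = (\<lambda>j. (if j \<in> F then c j else 0) + (if j = i then d else 0))"
  have "(\<Sum>j\<in>insert i F. c' j * expi (l j * x)) = g x + d * expi (m * x)" for x
  proof -
    have "(\<Sum>j\<in>insert i F. c' j * expi (l j * x)) =
      (\<Sum>j\<in>insert i F. if j \<in> F then c j * expi (l j * x) else 0) +
      (\<Sum>j\<in>insert i F. if j = i then d * expi (l j * x) else 0)"
      unfolding c'_def sum.distrib[symmetric] by (intro sum.cong) (auto simp: algebra_simps)
    also have "(\<Sum>j\<in>insert i F. if j \<in> F then c j * expi (l j * x) else 0) = g x"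
      unfolding F(2) using F(1) by (intro sum.mono_neutral_cong_right) auto
    also have "(\<Sum>j\<in>insert i F. if j = i then d * expi (l j * x) else 0) = d * expi (m * x)"
      using F(1) by (simp add: m)
    finally show ?thesis .
  qed
  then show ?case using F(1) by (intro exI[of _ "insert i F"] exI[of _ c']) auto
qed

text \<open>
  The nonnegative integral makes this meaningful without integrability assumptions, with value \<open>\<infinity>\<close> for
  functions at infinite distance; the triangle inequality is used in the form with factors \<open>2\<close>.
\<close>
definition L2_sqdist :: "real set \<Rightarrow> (real \<Rightarrow> complex) \<Rightarrow> (real \<Rightarrow> complex) \<Rightarrow> ennreal" where
  "L2_sqdist S f g = (\<integral>\<^sup>+x\<in>S. ennreal ((cmod (f x - g x))\<^sup>2) \<partial>lborel)"

lemma cmod_add_power2_le: "(cmod (y + z))\<^sup>2 \<le> 2 * (cmod y)\<^sup>2 + 2 * (cmod z)\<^sup>2"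
proof -
  have "(cmod (y + z))\<^sup>2 \<le> (cmod y + cmod z)\<^sup>2" by (intro power_mono norm_triangle_ineq) simp
  also have "\<dots> \<le> 2 * (cmod y)\<^sup>2 + 2 * (cmod z)\<^sup>2"
    using sum_squares_bound[of "cmod y" "cmod z"] by (simp add: power2_sum)
  finally show ?thesis .
qed

lemma L2_sqdist_add_le:
  assumes [measurable]: "S \<in> sets borel" "f \<in> borel_measurable borel" "f' \<in> borel_measurable borel"
    "g \<in> borel_measurable borel" "g' \<in> borel_measurable borel"
  shows "L2_sqdist S (\<lambda>x. f x + f' x) (\<lambda>x. g x + g' x) \<le> 2 * L2_sqdist S f g + 2 * L2_sqdist S f' g'"
proof -
  have pt: "ennreal ((cmod (f x + f' x - (g x + g' x)))\<^sup>2) \<le>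
    2 * ennreal ((cmod (f x - g x))\<^sup>2) + 2 * ennreal ((cmod (f' x - g' x))\<^sup>2)" for x
  proof -
    have "ennreal ((cmod (f x + f' x - (g x + g' x)))\<^sup>2) \<le>
      ennreal (2 * (cmod (f x - g x))\<^sup>2 + 2 * (cmod (f' x - g' x))\<^sup>2)"
      using cmod_add_power2_le[of "f x - g x" "f' x - g' x"] by (intro ennreal_leI) (simp add: algebra_simps)
    then show ?thesis by (simp add: ennreal_mult)
  qed
  have "L2_sqdist S (\<lambda>x. f x + f' x) (\<lambda>x. g x + g' x) \<le>
    (\<integral>\<^sup>+x. 2 * (ennreal ((cmod (f x - g x))\<^sup>2) * indicator S x) +
      2 * (ennreal ((cmod (f' x - g' x))\<^sup>2) * indicator S x) \<partial>lborel)"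
    unfolding L2_sqdist_def using pt by (intro nn_integral_mono) (auto simp: indicator_def)
  also have "\<dots> = 2 * L2_sqdist S f g + 2 * L2_sqdist S f' g'"
    unfolding L2_sqdist_def by (simp add: nn_integral_add nn_integral_cmult)
  finally show ?thesis .
qed

lemma L2_sqdist_triangle:
  assumes "S \<in> sets borel" "f \<in> borel_measurable borel" "g \<in> borel_measurable borel" "h \<in> borel_measurable borel"
  shows "L2_sqdist S f h \<le> 2 * L2_sqdist S f g + 2 * L2_sqdist S g h"
proof -
  have "L2_sqdist S f h = L2_sqdist S (\<lambda>x. (f x - g x) + g x) (\<lambda>x. 0 + h x)" by (simp add: L2_sqdist_def)
  also have "\<dots> \<le> 2 * L2_sqdist S (\<lambda>x. f x - g x) (\<lambda>x. 0) + 2 * L2_sqdist S g h"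
    using assms by (intro L2_sqdist_add_le) auto
  also have "L2_sqdist S (\<lambda>x. f x - g x) (\<lambda>x. 0) = L2_sqdist S f g" by (simp add: L2_sqdist_def)
  finally show ?thesis .
qed

lemma L2_sqdist_scale:
  assumes [measurable]: "S \<in> sets borel" "f \<in> borel_measurable borel" "g \<in> borel_measurable borel"
  shows "L2_sqdist S (\<lambda>x. c * f x) (\<lambda>x. c * g x) = ennreal ((cmod c)\<^sup>2) * L2_sqdist S f g"
proof -
  have "cmod (c * f x - c * g x) = cmod c * cmod (f x - g x)" for x
    by (simp add: norm_mult[symmetric] right_diff_distrib)
  then show ?thesis unfolding L2_sqdist_def
    by (simp add: power_mult_distrib ennreal_mult nn_integral_cmult[symmetric] mult.assoc)
qed

lemma L2_sqdist_unimodular: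
  assumes "\<And>x. cmod (e x) = 1"
  shows "L2_sqdist S (\<lambda>x. e x * f x) (\<lambda>x. e x * g x) = L2_sqdist S f g"
proof -
  have "cmod (e x * f x - e x * g x) = cmod (f x - g x)" for x
    using assms by (simp add: right_diff_distrib[symmetric] norm_mult)
  then show ?thesis by (simp add: L2_sqdist_def)
qed

definition expclosure :: "real set \<Rightarrow> real set \<Rightarrow> (real \<Rightarrow> complex) set" where
  "expclosure L S = {f \<in> borel_measurable borel. \<forall>\<epsilon>>0. \<exists>g\<in>expspan L. L2_sqdist S f g \<le> ennreal \<epsilon>}"

lemma expclosureI:
  "f \<in> borel_measurable borel \<Longrightarrow> (\<And>\<epsilon>. \<epsilon> > 0 \<Longrightarrow> \<exists>g\<in>expspan L. L2_sqdist S f g \<le> ennreal \<epsilon>) \<Longrightarrow>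
    f \<in> expclosure L S"
  by (auto simp: expclosure_def)

lemma expclosureD:
  "f \<in> expclosure L S \<Longrightarrow> \<epsilon> > 0 \<Longrightarrow> \<exists>g\<in>expspan L. L2_sqdist S f g \<le> ennreal \<epsilon>"
  by (auto simp: expclosure_def)

lemma expclosure_measurable: "f \<in> expclosure L S \<Longrightarrow> f \<in> borel_measurable borel"
  by (auto simp: expclosure_def)

lemma two_quarters_ennreal:
  assumes "x \<le> ennreal (\<epsilon> / 4)" "y \<le> ennreal (\<epsilon> / 4)" "\<epsilon> > 0"
  shows "2 * x + 2 * y \<le> ennreal \<epsilon>"
proof -
  have "2 * x + 2 * y \<le> 2 * ennreal (\<epsilon> / 4) + 2 * ennreal (\<epsilon> / 4)"
    using assms by (intro add_mono mult_left_mono) auto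
  also have "2 * ennreal (\<epsilon> / 4) = ennreal (\<epsilon> / 2)"
    using ennreal_mult[of 2 "\<epsilon> / 4"] assms(3) by simp
  also have "ennreal (\<epsilon> / 2) + ennreal (\<epsilon> / 2) = ennreal \<epsilon>"
    using assms(3) by (simp flip: ennreal_plus)
  finally show ?thesis .
qed

lemma expclosure_closed:
  assumes S: "S \<in> sets borel" and f: "f \<in> borel_measurable borel"
    and near: "\<And>\<epsilon>. \<epsilon> > 0 \<Longrightarrow> \<exists>g\<in>expclosure L S. L2_sqdist S f g \<le> ennreal \<epsilon>"
  shows "f \<in> expclosure L S"
proof (rule expclosureI[OF f])
  fix \<epsilon> :: real assume "\<epsilon> > 0"
  then obtain g where g: "g \<in> expclosure L S" "L2_sqdist S f g \<le> ennreal (\<epsilon> / 4)"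
    using near[of "\<epsilon> / 4"] by auto
  obtain h where h: "h \<in> expspan L" "L2_sqdist S g h \<le> ennreal (\<epsilon> / 4)"
    using expclosureD[OF g(1), of "\<epsilon> / 4"] \<open>\<epsilon> > 0\<close> by auto
  have "L2_sqdist S f h \<le> 2 * L2_sqdist S f g + 2 * L2_sqdist S g h"
    using S f expclosure_measurable[OF g(1)] expspan_measurable[OF h(1)] by (rule L2_sqdist_triangle)
  also have "\<dots> \<le> ennreal \<epsilon>" using g(2) h(2) \<open>\<epsilon> > 0\<close> by (rule two_quarters_ennreal)
  finally show "\<exists>g\<in>expspan L. L2_sqdist S f g \<le> ennreal \<epsilon>" using h(1) by blast
qed

lemma expclosure_limit:
  assumes S [measurable]: "S \<in> sets borel" and f [measurable]: "f \<in> borel_measurable borel"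
    and g: "\<And>n. g n \<in> expclosure L S"
    and lim: "\<And>x. x \<in> S \<Longrightarrow> (\<lambda>n. g n x) \<longlonglongrightarrow> f x"
    and w [measurable]: "w \<in> borel_measurable borel"
    and bound: "\<And>n x. x \<in> S \<Longrightarrow> ennreal ((cmod (f x - g n x))\<^sup>2) \<le> w x"
    and fin: "(\<integral>\<^sup>+x\<in>S. w x \<partial>lborel) < \<infinity>"
  shows "f \<in> expclosure L S"
proof (rule expclosure_closed[OF S f])
  fix \<epsilon> :: real assume "\<epsilon> > 0"
  have [measurable]: "g n \<in> borel_measurable borel" for n using g by (rule expclosure_measurable)
  have "(\<lambda>n. L2_sqdist S f (g n)) \<longlonglongrightarrow> (\<integral>\<^sup>+(x::real). 0 \<partial>lborel)"
    unfolding L2_sqdist_def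
  proof (rule nn_integral_dominated_convergence[where u = "\<lambda>n x. ennreal ((cmod (f x - g n x))\<^sup>2) * indicator S x"
        and u' = "\<lambda>x. 0" and w = "\<lambda>x. w x * indicator S x" and M = lborel])
    show "AE x in lborel. (\<lambda>n. ennreal ((cmod (f x - g n x))\<^sup>2) * indicator S x) \<longlonglongrightarrow> 0"
    proof (rule AE_I2)
      fix x
      show "(\<lambda>n. ennreal ((cmod (f x - g n x))\<^sup>2) * indicator S x) \<longlonglongrightarrow> 0"
      proof (cases "x \<in> S")
        case True
        have "(\<lambda>n. (cmod (f x - g n x))\<^sup>2) \<longlonglongrightarrow> (cmod (f x - f x))\<^sup>2"
          using lim[OF True] by (intro tendsto_intros)
        then have "(\<lambda>n. ennreal ((cmod (f x - g n x))\<^sup>2)) \<longlonglongrightarrow> ennreal ((cmod (f x - f x))\<^sup>2)"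
          by (rule tendsto_ennrealI)
        then show ?thesis using True by simp
      qed simp
    qed
  qed (use bound fin in \<open>auto simp: indicator_def intro!: AE_I2\<close>)
  then have "eventually (\<lambda>n. L2_sqdist S f (g n) < ennreal \<epsilon>) sequentially"
    using \<open>\<epsilon> > 0\<close> by (intro order_tendstoD(2)) auto
  then obtain n where "L2_sqdist S f (g n) < ennreal \<epsilon>" by (auto simp: eventually_sequentially)
  then show "\<exists>g\<in>expclosure L S. L2_sqdist S f g \<le> ennreal \<epsilon>" using g by (intro bexI[of _ "g n"]) auto
qed

lemma expclosure_add:
  assumes S: "S \<in> sets borel" and f: "f \<in> expclosure L S" and f': "f' \<in> expclosure L S"
  shows "(\<lambda>x. f x + f' x) \<in> expclosure L S"
proof (rule expclosureI)
  note [measurable] = expclosure_measurable[OF f] expclosure_measurable[OF f']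
  show "(\<lambda>x. f x + f' x) \<in> borel_measurable borel" by measurable
  fix \<epsilon> :: real assume "\<epsilon> > 0"
  obtain g where g: "g \<in> expspan L" "L2_sqdist S f g \<le> ennreal (\<epsilon> / 4)"
    using expclosureD[OF f, of "\<epsilon> / 4"] \<open>\<epsilon> > 0\<close> by auto
  obtain g' where g': "g' \<in> expspan L" "L2_sqdist S f' g' \<le> ennreal (\<epsilon> / 4)"
    using expclosureD[OF f', of "\<epsilon> / 4"] \<open>\<epsilon> > 0\<close> by auto
  have "L2_sqdist S (\<lambda>x. f x + f' x) (\<lambda>x. g x + g' x) \<le> 2 * L2_sqdist S f g + 2 * L2_sqdist S f' g'"
    using S f f' g g' by (intro L2_sqdist_add_le expclosure_measurable expspan_measurable)
  also have "\<dots> \<le> ennreal \<epsilon>" using g(2) g'(2) \<open>\<epsilon> > 0\<close> by (rule two_quarters_ennreal)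
  finally show "\<exists>g\<in>expspan L. L2_sqdist S (\<lambda>x. f x + f' x) g \<le> ennreal \<epsilon>"
    using expspan_add[OF g(1) g'(1)] by blast
qed

lemma expclosure_scale:
  assumes S: "S \<in> sets borel" and f: "f \<in> expclosure L S"
  shows "(\<lambda>x. c * f x) \<in> expclosure L S"
proof (rule expclosureI)
  note [measurable] = expclosure_measurable[OF f]
  show "(\<lambda>x. c * f x) \<in> borel_measurable borel" by measurable
  fix \<epsilon> :: real assume "\<epsilon> > 0"
  define \<delta> where "\<delta> = \<epsilon> / ((cmod c)\<^sup>2 + 1)"
  have pos: "(cmod c)\<^sup>2 + 1 > 0" by (simp add: add_nonneg_pos)
  then have "\<delta> > 0" using \<open>\<epsilon> > 0\<close> by (simp add: \<delta>_def)
  then obtain g where g: "g \<in> expspan L" "L2_sqdist S f g \<le> ennreal \<delta>" using expclosureD[OF f] by blast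
  have "L2_sqdist S (\<lambda>x. c * f x) (\<lambda>x. c * g x) = ennreal ((cmod c)\<^sup>2) * L2_sqdist S f g"
    using S f g(1) by (intro L2_sqdist_scale expclosure_measurable expspan_measurable)
  also have "\<dots> \<le> ennreal ((cmod c)\<^sup>2) * ennreal \<delta>" using g(2) by (intro mult_left_mono) auto
  also have "\<dots> = ennreal ((cmod c)\<^sup>2 * \<delta>)" using \<open>\<delta> > 0\<close> by (simp add: ennreal_mult)
  also have "(cmod c)\<^sup>2 * \<delta> \<le> \<epsilon>"
    using pos \<open>\<epsilon> > 0\<close> unfolding \<delta>_def by (simp add: field_simps)
  finally show "\<exists>g\<in>expspan L. L2_sqdist S (\<lambda>x. c * f x) g \<le> ennreal \<epsilon>"
    using expspan_scale[OF g(1)] by (meson ennreal_leI order_trans)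
qed

lemma expclosure_sum:
  assumes "S \<in> sets borel" "finite I" "\<And>i. i \<in> I \<Longrightarrow> f i \<in> expclosure L S"
  shows "(\<lambda>x. \<Sum>i\<in>I. f i x) \<in> expclosure L S"
  using assms(2,3)
proof (induction rule: finite_induct)
  case empty
  show ?case by (intro expclosureI bexI[OF _ expspan.zero]) (auto simp: L2_sqdist_def)
qed (use assms(1) in \<open>simp add: expclosure_add\<close>)

text \<open>The frequencies of the exponentials with period \<open>P\<close>.\<close>
definition freqs :: "real \<Rightarrow> real set" where
  "freqs P = range (\<lambda>k::int. of_int k / P)"

text \<open>On the unit circle the coordinates are combinations of \<open>z\<close> and its conjugate, that is, of
  \<open>e(x / P)\<close> and \<open>e(- x / P)\<close>.\<close>
lemma trig_polynomial_of_real_polynomial: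
  assumes "real_polynomial_function (g :: complex \<Rightarrow> real)"
  shows "(\<lambda>x. complex_of_real (g (expi (x / P)))) \<in> expspan (freqs P)"
  using assms
proof induction
  case (linear f)
  interpret bounded_linear f by fact
  have f: "f z = Re z * f 1 + Im z * f \<i>" for z
  proof -
    have "z = Re z *\<^sub>R 1 + Im z *\<^sub>R \<i>" by (simp add: complex_eq_iff)
    then have "f z = f (Re z *\<^sub>R 1 + Im z *\<^sub>R \<i>)" by (rule arg_cong)
    then show ?thesis unfolding add scaleR by simp
  qed
  define \<alpha> where "\<alpha> = Complex (f 1 / 2) (- f \<i> / 2)"
  have \<alpha>: "complex_of_real (f z) = \<alpha> * z + cnj \<alpha> * cnj z" for z
    unfolding f[of z] by (rule complex_eqI) (simp_all add: \<alpha>_def)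
  have conj: "cnj (expi (x / P)) = expi (of_int (- 1) / P * x)" for x by (simp add: cnj_expi)
  have eq: "(\<lambda>x. complex_of_real (f (expi (x / P)))) =
    (\<lambda>x. \<alpha> * expi (of_int 1 / P * x) + cnj \<alpha> * expi (of_int (- 1) / P * x))"
    unfolding \<alpha> conj by simp
  show ?case unfolding eq by (intro expspan_add expspan_term) (unfold freqs_def, blast+)
next
  case (const c)
  have "(\<lambda>x. complex_of_real c * expi (of_int 0 / P * x)) \<in> expspan (freqs P)"
    by (intro expspan_term) (unfold freqs_def, blast)
  then show ?case by simp
next
  case (add f g)
  then show ?case using expspan_add by force
next
  case (mult f g)
  have "l + m \<in> freqs P" if "l \<in> freqs P" "m \<in> freqs P" for l m
    using that unfolding freqs_def by (auto simp: add_divide_distrib[symmetric] of_int_add[symmetric] simp del: of_int_add)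
  then show ?case using expspan_mult[OF mult.IH] by simp
qed

text \<open>Stone-Weierstrass on the unit circle gives uniform approximation, which is stronger.\<close>
lemma expclosure_continuous:
  fixes g :: "complex \<Rightarrow> real"
  assumes P: "P > 0" and cont: "continuous_on UNIV g"
  shows "(\<lambda>x. complex_of_real (g (expi (x / P)))) \<in> expclosure (freqs P) {a..<a + P}"
proof (rule expclosureI)
  have [measurable]: "g \<in> borel_measurable borel" using cont by (rule borel_measurable_continuous_onI)
  show "(\<lambda>x. complex_of_real (g (expi (x / P)))) \<in> borel_measurable borel" by measurable
  fix \<epsilon> :: real assume "\<epsilon> > 0"
  define e where "e = sqrt (\<epsilon> / P)"
  have e: "e > 0" "e\<^sup>2 * P = \<epsilon>" using P \<open>\<epsilon> > 0\<close> by (auto simp: e_def)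
  obtain h where h: "real_polynomial_function h" "\<And>z. z \<in> sphere 0 1 \<Longrightarrow> \<bar>g z - h z\<bar> < e"
    using Stone_Weierstrass_real_polynomial_function[of "sphere 0 1" g e] e(1) cont continuous_on_subset
    by (metis compact_sphere subset_UNIV)
  have pt: "(cmod (complex_of_real (g (expi (x / P))) - complex_of_real (h (expi (x / P)))))\<^sup>2 \<le> e\<^sup>2" for x
  proof -
    have "cmod (complex_of_real (g (expi (x / P))) - complex_of_real (h (expi (x / P)))) < e"
      using h(2)[of "expi (x / P)"] by (simp flip: of_real_diff)
    then show ?thesis by (intro power_mono) auto
  qed
  have "L2_sqdist {a..<a + P} (\<lambda>x. complex_of_real (g (expi (x / P)))) (\<lambda>x. complex_of_real (h (expi (x / P))))
    \<le> (\<integral>\<^sup>+x. ennreal (e\<^sup>2) * indicator {a..<a + P} x \<partial>lborel)"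
    unfolding L2_sqdist_def using pt by (intro nn_integral_mono mult_right_mono ennreal_leI) auto
  also have "\<dots> = ennreal \<epsilon>" using P e by (simp add: nn_integral_cmult_indicator ennreal_mult[symmetric])
  finally show "\<exists>k\<in>expspan (freqs P). L2_sqdist {a..<a + P} (\<lambda>x. complex_of_real (g (expi (x / P)))) k \<le> ennreal \<epsilon>"
    using trig_polynomial_of_real_polynomial[OF h(1)] by blast
qed

text \<open>
  The map \<open>x \<mapsto> e(x / P)\<close> sends the complement of \<open>V\<close> in the closed period to a compact set \<open>K\<close>, and is
  injective enough for \<open>K\<close> to miss the image of \<open>V\<close>. The continuous functions
  \<open>min 1 (n * dist z K)\<close> on the circle then increase to the indicator function of \<open>V\<close>.
\<close>
lemma expclosure_open:
  assumes P: "P > 0" and V: "open V" "V \<subseteq> {a<..<a + P}"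
  shows "indicator V \<in> expclosure (freqs P) {a..<a + P}"
proof -
  define K where "K = (\<lambda>x. expi (x / P)) ` ({a..a + P} - V)"
  have "compact ({a..a + P} - V)" using V(1) by (intro compact_diff) auto
  then have "compact K" unfolding K_def by (intro compact_continuous_image continuous_intros) (use P in auto)
  then have "closed K" by (rule compact_imp_closed)
  have "a \<in> {a..a + P} - V" using P V(2) by auto
  then have "K \<noteq> {}" unfolding K_def by blast
  define h where "h n z = min 1 (real n * infdist z K)" for n z
  have mem: "expi (x / P) \<in> K \<longleftrightarrow> x \<notin> V" if x: "x \<in> {a..<a + P}" for x
  proof
    assume "expi (x / P) \<in> K"
    then obtain y where y: "y \<in> {a..a + P}" "y \<notin> V" "expi (x / P) = expi (y / P)" unfolding K_def by blast
    then have "(x - y) / P \<in> \<int>" unfolding expi_eq_iff by (simp add: diff_divide_distrib)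
    then obtain k :: int where k: "x - y = of_int k * P" using P by (auto elim!: Ints_cases simp: field_simps)
    show "x \<notin> V"
    proof
      assume "x \<in> V"
      then have "a < x" using V(2) by auto
      then have "of_int k * P < 1 * P" "- 1 * P < of_int k * P" using x y(1) unfolding k[symmetric] by auto
      then have "k = 0" using P unfolding mult_less_cancel_right_pos[OF P] by linarith
      then show False using k y(2) \<open>x \<in> V\<close> by simp
    qed
  qed (use x K_def in auto)
  show ?thesis
  proof (rule expclosure_limit[where g = "\<lambda>n x. complex_of_real (h n (expi (x / P)))" and w = "\<lambda>x. 1"])
    show "(indicator V :: real \<Rightarrow> complex) \<in> borel_measurable borel"
      using borel_open[OF V(1)] by measurable
    show "(\<lambda>x. complex_of_real (h n (expi (x / P)))) \<in> expclosure (freqs P) {a..<a + P}" for n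
      unfolding h_def by (intro expclosure_continuous P continuous_intros)
    show "(\<lambda>n. complex_of_real (h n (expi (x / P)))) \<longlonglongrightarrow> indicator V x" if x: "x \<in> {a..<a + P}" for x
    proof (cases "x \<in> V")
      case True
      then have pos: "infdist (expi (x / P)) K > 0"
        using mem[OF x] \<open>closed K\<close> \<open>K \<noteq> {}\<close> by (intro infdist_pos_not_in_closed) auto
      obtain N :: nat where N: "1 / infdist (expi (x / P)) K < real N" using reals_Archimedean2 by blast
      have "h n (expi (x / P)) = 1" if "n \<ge> N" for n
      proof -
        have "1 / infdist (expi (x / P)) K \<le> real n" using N that by linarith
        then show ?thesis using pos unfolding h_def by (simp add: field_simps)
      qed
      then show ?thesis using True by (intro tendsto_eventually) (auto simp: eventually_sequentially)
    next
      case False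
      then show ?thesis using mem[OF x] by (simp add: h_def)
    qed
    show "ennreal ((cmod (indicator V x - complex_of_real (h n (expi (x / P)))))\<^sup>2) \<le> 1" for n x
    proof -
      have "0 \<le> h n (expi (x / P))" "h n (expi (x / P)) \<le> 1" unfolding h_def by (auto simp: infdist_nonneg)
      then have "\<bar>indicator V x - h n (expi (x / P))\<bar> \<le> 1" by (auto simp: indicator_def)
      moreover have "indicator V x - complex_of_real (h n (expi (x / P))) =
        complex_of_real (indicator V x - h n (expi (x / P)))"
        by (cases "x \<in> V") simp_all
      ultimately have "cmod (indicator V x - complex_of_real (h n (expi (x / P)))) \<le> 1"
        by (simp only: norm_of_real)
      then have "(cmod (indicator V x - complex_of_real (h n (expi (x / P)))))\<^sup>2 \<le> 1\<^sup>2"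
        by (rule power_mono) simp
      then show ?thesis by simp
    qed
  qed (use P in auto)
qed

text \<open>Lebesgue measure is outer regular.\<close>
lemma expclosure_borel_set:
  assumes P: "P > 0" and A: "A \<in> sets borel"
  shows "indicator A \<in> expclosure (freqs P) {a..<a + P}"
proof (rule expclosure_closed)
  show "(indicator A :: real \<Rightarrow> complex) \<in> borel_measurable borel" using A by measurable
  fix \<epsilon> :: real assume "\<epsilon> > 0"
  define B where "B = A \<inter> {a<..<a + P}"
  have B: "B \<in> sets borel" using A unfolding B_def by simp
  obtain U where U: "open U" "B \<subseteq> U" "emeasure lborel (U - B) < ennreal \<epsilon>"
    using outer_regular_lborel[OF B \<open>\<epsilon> > 0\<close>] .
  define V where "V = U \<inter> {a<..<a + P}"
  have "AE x in lborel. x \<noteq> a" by (rule AE_lborel_singleton)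
  then have "AE x in lborel. ennreal ((cmod (indicator A x - indicator V x))\<^sup>2) * indicator {a..<a + P} x \<le>
    indicator (U - B) x"
  proof eventually_elim
    case (elim x)
    then show ?case using U(2) by (auto simp: indicator_def V_def B_def)
  qed
  then have "L2_sqdist {a..<a + P} (indicator A) (indicator V) \<le> (\<integral>\<^sup>+x. indicator (U - B) x \<partial>lborel)"
    unfolding L2_sqdist_def by (rule nn_integral_mono_AE)
  also have "\<dots> = emeasure lborel (U - B)" using U(1) B by simp
  finally have "L2_sqdist {a..<a + P} (indicator A) (indicator V) \<le> ennreal \<epsilon>" using U(3) by auto
  moreover have "indicator V \<in> expclosure (freqs P) {a..<a + P}"
    using U(1) unfolding V_def by (intro expclosure_open P) auto
  ultimately show "\<exists>g\<in>expclosure (freqs P) {a..<a + P}. L2_sqdist {a..<a + P} (indicator A) g \<le> ennreal \<epsilon>"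
    by blast
qed simp

text \<open>
  Simple functions converging to \<open>f\<close> with \<open>\<bar>s n\<bar> \<le> 2 \<bar>f\<bar>\<close> converge in \<open>L\<^sup>2\<close> by dominated convergence,
  with majorant \<open>9 \<bar>f\<bar>\<^sup>2\<close>.
\<close>
lemma trig_polynomials_dense:
  assumes P: "P > 0" and f [measurable]: "f \<in> borel_measurable borel"
    and fin: "(\<integral>\<^sup>+x\<in>{a..<a + P}. ennreal ((cmod (f x))\<^sup>2) \<partial>lborel) < \<infinity>"
  shows "f \<in> expclosure (freqs P) {a..<a + P}"
proof -
  obtain s where s: "\<And>n. simple_function borel (s n)" "\<And>x. (\<lambda>n. s n x) \<longlonglongrightarrow> f x"
    "\<And>n x. dist (s n x) 0 \<le> 2 * dist (f x) 0"
    using borel_measurable_implies_sequence_metric[OF f, of 0] by auto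
  show ?thesis
  proof (rule expclosure_limit[where g = s and w = "\<lambda>x. 9 * ennreal ((cmod (f x))\<^sup>2)"])
    show "s n \<in> expclosure (freqs P) {a..<a + P}" for n
    proof -
      have fin_range: "finite (range (s n))" using simple_functionD(1)[OF s(1)] by simp
      have "s n = (\<lambda>x. \<Sum>y\<in>range (s n). y * indicator (s n -` {y}) x)"
      proof
        fix x
        have "(\<Sum>y\<in>range (s n). y * indicator (s n -` {y}) x) = (\<Sum>y\<in>{s n x}. y * indicator (s n -` {y}) x)"
          using fin_range by (intro sum.mono_neutral_right) (auto simp: indicator_def)
        then show "s n x = (\<Sum>y\<in>range (s n). y * indicator (s n -` {y}) x)" by simp
      qed
      moreover have "(\<lambda>x. \<Sum>y\<in>range (s n). y * indicator (s n -` {y}) x) \<in> expclosure (freqs P) {a..<a + P}"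
      proof (rule expclosure_sum[OF _ fin_range])
        fix y
        have "s n -` {y} \<in> sets borel" using simple_functionD(2)[OF s(1), of n "{y}"] by simp
        then have "indicator (s n -` {y}) \<in> expclosure (freqs P) {a..<a + P}"
          by (rule expclosure_borel_set[OF P])
        then show "(\<lambda>x. y * indicator (s n -` {y}) x) \<in> expclosure (freqs P) {a..<a + P}"
          by (rule expclosure_scale[rotated]) simp
      qed simp
      ultimately show ?thesis by simp
    qed
    show "ennreal ((cmod (f x - s n x))\<^sup>2) \<le> 9 * ennreal ((cmod (f x))\<^sup>2)" for n x
    proof -
      have "cmod (f x - s n x) \<le> 3 * cmod (f x)"
        using norm_triangle_ineq4[of "f x" "s n x"] s(3)[of n x] by simp
      then have "(cmod (f x - s n x))\<^sup>2 \<le> (3 * cmod (f x))\<^sup>2" by (intro power_mono) auto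
      then have "ennreal ((cmod (f x - s n x))\<^sup>2) \<le> ennreal (9 * (cmod (f x))\<^sup>2)"
        by (intro ennreal_leI) (simp add: power_mult_distrib)
      then show ?thesis by (simp add: ennreal_mult)
    qed
    have "(\<integral>\<^sup>+x\<in>{a..<a + P}. 9 * ennreal ((cmod (f x))\<^sup>2) \<partial>lborel) =
      9 * (\<integral>\<^sup>+x\<in>{a..<a + P}. ennreal ((cmod (f x))\<^sup>2) \<partial>lborel)"
      by (simp add: nn_integral_cmult[symmetric] mult.assoc)
    then show "(\<integral>\<^sup>+x\<in>{a..<a + P}. 9 * ennreal ((cmod (f x))\<^sup>2) \<partial>lborel) < \<infinity>"
      using fin by (simp add: ennreal_mult_less_top)
  qed (use s(2) in auto)
qed

section \<open>Spectra in the commensurable cases\<close>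

lemma nn_integral_shift:
  assumes [measurable]: "G \<in> borel_measurable borel"
  shows "(\<integral>\<^sup>+x\<in>{c + t..<d + t}. G x \<partial>lborel) = (\<integral>\<^sup>+x\<in>{c..<d::real}. G (x + t) \<partial>lborel)"
proof -
  have "(\<integral>\<^sup>+x\<in>{c + t..<d + t}. G x \<partial>lborel) =
    ennreal \<bar>1\<bar> * (\<integral>\<^sup>+x. G (t + 1 * x) * indicator {c + t..<d + t} (t + 1 * x) \<partial>lborel)"
    by (rule nn_integral_real_affine) simp_all
  also have "\<dots> = (\<integral>\<^sup>+x\<in>{c..<d}. G (x + t) \<partial>lborel)"
    by (simp, intro nn_integral_cong) (auto simp: indicator_def add.commute)
  finally show ?thesis .
qed

lemma nn_integral_split:
  assumes [measurable]: "G \<in> borel_measurable borel" and "A \<in> sets borel" "B \<in> sets borel" "A \<inter> B = {}"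
  shows "(\<integral>\<^sup>+x\<in>A \<union> B. G x \<partial>(lborel :: real measure)) = (\<integral>\<^sup>+x\<in>A. G x \<partial>lborel) + (\<integral>\<^sup>+x\<in>B. G x \<partial>lborel)"
  using assms by (intro nn_integral_disjoint_pair) auto

context two_intervals
begin

lemma half_open_split:
  assumes [measurable]: "G \<in> borel_measurable borel"
  shows "(\<integral>\<^sup>+x\<in>{p..<q} \<union> {u..<v}. G x \<partial>lborel) =
    (\<integral>\<^sup>+x\<in>{p..<q}. G x \<partial>lborel) + (\<integral>\<^sup>+x\<in>{u..<v}. G x \<partial>lborel)"
  using qu by (intro nn_integral_split) auto

lemma AE_half_open: "AE x in lborel. x \<in> \<Omega> \<longleftrightarrow> x \<in> {p..<q} \<union> {u..<v}"
proof -
  have "AE x in lborel. x \<notin> {p, q, u, v}"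
    by (intro AE_not_in finite_imp_null_set_lborel) simp
  then show ?thesis
  proof eventually_elim
    case (elim x)
    have "x \<in> {p<..<q} \<union> {u<..<v} \<Longrightarrow> x \<in> \<Omega>" "x \<in> \<Omega> \<Longrightarrow> x \<in> {p..q} \<union> {u..v}"
      using inner outer by blast+
    then show ?case using elim by auto
  qed
qed

text \<open>
  This translates between the definition of a spectrum, in terms of functions on \<open>\<Omega>\<close>, and approximation
  of globally defined functions on the half-open intervals.
\<close>
lemma has_spectrum_if_dense:
  fixes l :: "int \<Rightarrow> real"
  assumes inj: "inj l" and zeros: "\<And>i j. i \<noteq> j \<Longrightarrow> endpoint_sum (l i - l j) = 0"
    and dense: "\<And>f. f \<in> borel_measurable borel \<Longrightarrow>
      (\<integral>\<^sup>+x\<in>{p..<q} \<union> {u..<v}. ennreal ((cmod (f x))\<^sup>2) \<partial>lborel) < \<infinity> \<Longrightarrow>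
      f \<in> expclosure (range l) ({p..<q} \<union> {u..<v})"
  shows "has_spectrum \<Omega>"
proof -
  let ?M = "restrict_space lborel \<Omega>"
  let ?H = "{p..<q} \<union> {u..<v}"
  have "finite_measure ?M"
    by (rule finite_measureI) (simp add: space_restrict_space emeasure_restrict_space emeasure_\<Omega>)
  then interpret finite_measure ?M .
  have "square_integrable ?M (\<lambda>x. expi (l i * x))" for i
    unfolding square_integrable_def
    by (auto intro!: measurable_restrict_space1 borel_measurable_continuous_onI continuous_intros)
  moreover have "L2_inner ?M (\<lambda>x. expi (l i * x)) (\<lambda>x. expi (l j * x)) = (if i = j then 1 else 0)" for i j
    using zeros[of i j] inj unfolding inner_expi by (auto dest: injD)
  moreover have "\<exists>F c. finite F \<and> L2_norm ?M (\<lambda>x. f x - (\<Sum>i\<in>F. c i * expi (l i * x))) < \<epsilon>"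
    if f: "square_integrable ?M f" and \<epsilon>: "\<epsilon> > 0" for f \<epsilon>
  proof -
    define f' where "f' x = indicator \<Omega> x *\<^sub>R f x" for x
    have [measurable]: "f' \<in> borel_measurable borel"
      using f unfolding f'_def square_integrable_def
      by (simp add: borel_measurable_restrict_space_iff)
    have AE: "AE x in lborel. ennreal ((cmod (f x - h x))\<^sup>2) * indicator \<Omega> x =
      ennreal ((cmod (f' x - h x))\<^sup>2) * indicator ?H x" for h
      using AE_half_open by eventually_elim (auto simp: f'_def indicator_def)
    have restrict: "(\<integral>\<^sup>+x. ennreal ((cmod (f x - h x))\<^sup>2) \<partial>?M) = L2_sqdist ?H f' h" for h
      unfolding L2_sqdist_def by (subst nn_integral_restrict_space) (simp_all add: nn_integral_cong_AE[OF AE])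
    have "(\<integral>\<^sup>+x. ennreal (norm ((cmod (f x))\<^sup>2)) \<partial>?M) < \<infinity>"
      using f unfolding square_integrable_def by (auto simp: integrable_iff_bounded)
    then have "(\<integral>\<^sup>+x\<in>?H. ennreal ((cmod (f' x))\<^sup>2) \<partial>lborel) < \<infinity>"
      using restrict[of "\<lambda>x. 0"] by (simp add: L2_sqdist_def)
    then have "f' \<in> expclosure (range l) ?H" by (intro dense) measurable
    then obtain g where g: "g \<in> expspan (range l)" "L2_sqdist ?H f' g \<le> ennreal ((\<epsilon> / 2)\<^sup>2)"
      using expclosureD[of f' "range l" ?H "(\<epsilon> / 2)\<^sup>2"] \<epsilon> by auto
    obtain F c where F: "finite F" "g = (\<lambda>x. \<Sum>i\<in>F. c i * expi (l i * x))"
      using expspan_range_eq_sum[OF g(1)] by blast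
    have "(LINT x|?M. (cmod (f x - g x))\<^sup>2) \<le> (\<epsilon> / 2)\<^sup>2"
      using g(2) unfolding restrict[symmetric] by (intro integral_real_bounded) auto
    then have "L2_norm ?M (\<lambda>x. f x - g x) \<le> \<epsilon> / 2"
      using \<epsilon> unfolding L2_norm_def by (intro real_le_lsqrt) auto
    then have "L2_norm ?M (\<lambda>x. f x - g x) < \<epsilon>" using \<epsilon> by simp
    then show ?thesis using F by auto
  qed
  ultimately have "L2_orthonormal_basis ?M (\<lambda>k x. expi (l k * x))"
    unfolding L2_orthonormal_basis_def by blast
  then show ?thesis using inj unfolding has_spectrum_def is_spectrum_def exp_eq_expi by blast
qed

text \<open>
  Moving \<open>[u, v)\<close> to the left by \<open>k\<close> completes \<open>[p, q)\<close> to the unit interval \<open>[p, p + 1)\<close>, and the exponentials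
  with integer frequencies are invariant under this translation.
\<close>
lemma has_spectrum_integer_gap:
  assumes k: "u = q + of_int k"
  shows "has_spectrum \<Omega>"
proof (rule has_spectrum_if_dense[of "\<lambda>i. of_int i"])
  let ?H = "{p..<q} \<union> {u..<v}"
  have v: "v = p + 1 + of_int k" using k total_length by simp
  show "inj (real_of_int)" by (simp add: inj_on_def)
  show "endpoint_sum (of_int i - of_int j) = 0" for i j
  proof -
    define t where "t = real_of_int i - of_int j"
    have "expi (t * v) = expi (t * p)" "expi (t * u) = expi (t * q)"
      unfolding expi_eq_iff k v t_def by (simp_all add: algebra_simps)
    then show ?thesis unfolding endpoint_sum_def t_def by simp
  qed
  fix f :: "real \<Rightarrow> complex"
  assume f [measurable]: "f \<in> borel_measurable borel"
    and fin: "(\<integral>\<^sup>+x\<in>?H. ennreal ((cmod (f x))\<^sup>2) \<partial>lborel) < \<infinity>"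
  have freqs: "freqs 1 = range real_of_int" by (simp add: freqs_def)
  have fold: "(\<integral>\<^sup>+x\<in>?H. G x \<partial>lborel) = (\<integral>\<^sup>+x\<in>{p..<p + 1}. (if x < q then G x else G (x + k)) \<partial>lborel)"
    if [measurable]: "G \<in> borel_measurable borel" for G :: "real \<Rightarrow> ennreal"
  proof -
    have "(\<integral>\<^sup>+x\<in>{u..<v}. G x \<partial>lborel) = (\<integral>\<^sup>+x\<in>{q..<p + 1}. G (x + k) \<partial>lborel)"
      unfolding k v by (rule nn_integral_shift) measurable
    then have "(\<integral>\<^sup>+x\<in>?H. G x \<partial>lborel) =
      (\<integral>\<^sup>+x\<in>{p..<q}. G x \<partial>lborel) + (\<integral>\<^sup>+x\<in>{q..<p + 1}. G (x + k) \<partial>lborel)"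
      by (simp add: half_open_split)
    also have "\<dots> = (\<integral>\<^sup>+x. G x * indicator {p..<q} x + G (x + k) * indicator {q..<p + 1} x \<partial>lborel)"
      by (subst nn_integral_add) simp_all
    also have "\<dots> = (\<integral>\<^sup>+x\<in>{p..<p + 1}. (if x < q then G x else G (x + k)) \<partial>lborel)"
      using pq uv total_length by (intro nn_integral_cong) (auto simp: indicator_def)
    finally show ?thesis .
  qed
  define f' where "f' x = (if x < q then f x else f (x + k))" for x
  have [measurable]: "f' \<in> borel_measurable borel" unfolding f'_def by measurable
  have "(\<integral>\<^sup>+x\<in>{p..<p + 1}. ennreal ((cmod (f' x))\<^sup>2) \<partial>lborel) = (\<integral>\<^sup>+x\<in>?H. ennreal ((cmod (f x))\<^sup>2) \<partial>lborel)"
    by (subst fold) (auto simp: f'_def intro!: nn_integral_cong)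
  then have f': "f' \<in> expclosure (freqs 1) {p..<p + 1}" using fin by (intro trig_polynomials_dense) auto
  show "f \<in> expclosure (range real_of_int) ?H"
  proof (rule expclosureI[OF f])
    fix \<epsilon> :: real assume "\<epsilon> > 0"
    then obtain g where g: "g \<in> expspan (freqs 1)" "L2_sqdist {p..<p + 1} f' g \<le> ennreal \<epsilon>"
      using expclosureD[OF f'] by blast
    have [measurable]: "g \<in> borel_measurable borel" using g(1) by (rule expspan_measurable)
    have period: "g (x + k) = g x" for x :: real using g(1) by (rule expspan_shift) (auto simp: freqs)
    have "L2_sqdist ?H f g = L2_sqdist {p..<p + 1} f' g"
      unfolding L2_sqdist_def by (subst fold) (auto simp: f'_def period intro!: nn_integral_cong)
    then show "\<exists>g\<in>expspan (range real_of_int). L2_sqdist ?H f g \<le> ennreal \<epsilon>"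
      using g unfolding freqs by (intro bexI[of _ g]) simp_all
  qed
qed

text \<open>
  A function on \<open>\<Omega>\<close> is a pair \<open>(f1, f2)\<close> of functions on \<open>[p, p + 1/2)\<close>. An exponential with frequency in
  \<open>2 \<int>\<close> is a pair of equal functions. One with frequency in \<open>2 \<int> + 1/n\<close> is a pair of opposite functions,
  because translation by \<open>n/2\<close> multiplies it by \<open>e(1/2) = - 1\<close>; it is \<open>e(x / n)\<close> times an exponential with
  frequency in \<open>2 \<int>\<close>. So \<open>(f1 + f2) / 2\<close> and \<open>e(- x / n) (f1 - f2) / 2\<close> have to be approximated
  by trigonometric polynomials of period \<open>1/2\<close>.
\<close>
lemma has_spectrum_equal_halves:
  assumes half: "q - p = 1/2" and n: "2 * (u - p) = of_int n"
  shows "has_spectrum \<Omega>"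
proof -
  let ?H = "{p..<q} \<union> {u..<v}"
  have "n > 0" using n pq qu by (metis diff_gt_0_iff_gt less_le_trans mult_pos_pos of_int_0_less_iff zero_less_numeral)
  have ends: "q = p + 1/2" "u = p + n/2" "v = p + n/2 + 1/2"
    using half n total_length by (auto simp: field_simps)
  \<comment> \<open>Even indices enumerate \<open>2 \<int>\<close>, and the odd index \<open>2 m + 1\<close> stands for \<open>2 m + 1/n\<close>.\<close>
  define l where "l i = (if even i then of_int i else of_int (i - 1) + 1 / n)" for i :: int
  have range: "of_int (2 * m) \<in> range l" "of_int (2 * m) + 1 / n \<in> range l" for m
    by (rule range_eqI[of _ _ "2 * m"], simp add: l_def) (rule range_eqI[of _ _ "2 * m + 1"], simp add: l_def)
  have parity: "\<exists>a. i = 2 * a \<or> i = 2 * a + 1" for i :: int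
    by (metis evenE oddE)
  have difference: "\<exists>m. l i - l j = of_int (2 * m) \<or> l i - l j = of_int (2 * m) + 1 / n \<or> l i - l j = of_int (2 * m) - 1 / n"
    for i j
  proof -
    obtain a b where "i = 2 * a \<or> i = 2 * a + 1" "j = 2 * b \<or> j = 2 * b + 1" using parity by metis
    then show ?thesis by (intro exI[of _ "a - b"]) (auto simp: l_def)
  qed
  have zeros: "endpoint_sum (l i - l j) = 0" for i j
  proof -
    define t where "t = l i - l j"
    have factor: "endpoint_sum t = expi (t * p) * (expi (t / 2) - 1) * (1 + expi (t * n / 2))"
      unfolding endpoint_sum_def unfolding ends by (simp add: expi_add[symmetric] algebra_simps)
    have minus_1: "expi x = - 1" if "x - 1/2 \<in> \<int>" for x
    proof -
      have "expi x = expi (1/2)" using that unfolding expi_eq_iff .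
      then show ?thesis by (simp add: expi_def)
    qed
    obtain m where "t = of_int (2 * m) \<or> t = of_int (2 * m) + 1 / n \<or> t = of_int (2 * m) - 1 / n"
      using difference t_def by blast
    then consider "t = of_int (2 * m)" | "t * n / 2 = of_int (m * n) + 1/2" | "t * n / 2 = of_int (m * n - 1) + 1/2"
      using \<open>n > 0\<close> by (auto simp: field_simps)
    then have "expi (t / 2) = 1 \<or> expi (t * n / 2) = - 1"
    proof cases
      case 1
      then have "t / 2 = of_int m" by simp
      then show ?thesis unfolding expi_eq_1_iff by (metis Ints_of_int)
    next
      case 2
      then have "t * n / 2 - 1/2 = of_int (m * n)" by linarith
      then show ?thesis by (metis Ints_of_int minus_1)
    next
      case 3
      then have "t * n / 2 - 1/2 = of_int (m * n - 1)" by linarith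
      then show ?thesis by (metis Ints_of_int minus_1)
    qed
    then show ?thesis using factor unfolding t_def by auto
  qed
  have "inj l"
  proof (rule injI)
    fix i j assume eq: "l i = l j"
    obtain a b where ab: "i = 2 * a \<or> i = 2 * a + 1" "j = 2 * b \<or> j = 2 * b + 1" using parity by metis
    \<comment> \<open>The two cosets of \<open>2 \<int>\<close> are disjoint.\<close>
    have not_even: "1 / real_of_int n \<noteq> 2 * of_int m" for m
    proof
      assume "1 / real_of_int n = 2 * of_int m"
      then have "real_of_int (2 * (m * n)) = of_int 1" using \<open>n > 0\<close> by (simp add: field_simps)
      then have "2 * (m * n) = 1" unfolding of_int_eq_iff .
      then show False by presburger
    qed
    show "i = j"
      using ab eq not_even[of "a - b"] not_even[of "b - a"] by (auto simp: l_def)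
  qed
  then show ?thesis
  proof (rule has_spectrum_if_dense[OF _ zeros])
    fix f :: "real \<Rightarrow> complex"
    assume f [measurable]: "f \<in> borel_measurable borel"
      and fin: "(\<integral>\<^sup>+x\<in>?H. ennreal ((cmod (f x))\<^sup>2) \<partial>lborel) < \<infinity>"
    let ?I = "{p..<p + 1/2}"
    have fold: "(\<integral>\<^sup>+x\<in>?H. G x \<partial>lborel) = (\<integral>\<^sup>+x\<in>?I. G x \<partial>lborel) + (\<integral>\<^sup>+x\<in>?I. G (x + n/2) \<partial>lborel)"
      if [measurable]: "G \<in> borel_measurable borel" for G :: "real \<Rightarrow> ennreal"
    proof -
      have "{u..<v} = {p + n/2..<(p + 1/2) + n/2}" using ends by (simp add: algebra_simps)
      then have "(\<integral>\<^sup>+x\<in>{u..<v}. G x \<partial>lborel) = (\<integral>\<^sup>+x\<in>?I. G (x + n/2) \<partial>lborel)"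
        using nn_integral_shift[of G p "n/2" "p + 1/2"] by simp
      moreover have "{p..<q} = ?I" using ends by simp
      ultimately show ?thesis using half_open_split[OF that] by simp
    qed
    define f1 f2 where "f1 x = f x" and "f2 x = f (x + n/2)" for x
    have [measurable]: "f1 \<in> borel_measurable borel" "f2 \<in> borel_measurable borel"
      unfolding f1_def f2_def by measurable
    have fin12: "(\<integral>\<^sup>+x\<in>?I. ennreal ((cmod (f1 x))\<^sup>2) \<partial>lborel) < \<infinity>"
      "(\<integral>\<^sup>+x\<in>?I. ennreal ((cmod (f2 x))\<^sup>2) \<partial>lborel) < \<infinity>"
      using fin fold[of "\<lambda>x. ennreal ((cmod (f x))\<^sup>2)"] by (auto simp: f1_def f2_def)
    define e where "e x = expi (1 / n * x)" for x
    define e' where "e' x = expi (- (1 / n * x))" for x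
    have e_measurable [measurable]: "e \<in> borel_measurable borel" "e' \<in> borel_measurable borel"
      unfolding e_def e'_def by (intro borel_measurable_continuous_onI continuous_intros)+
    have e: "cmod (e x) = 1" "cmod (e' x) = 1" "e x * e' x = 1" for x
      unfolding e_def e'_def by (simp_all flip: expi_add)
    define A C where "A x = 1/2 * (f1 x + f2 x)" and "C x = 1/2 * (e' x * f1 x + (- 1) * (e' x * f2 x))" for x
    have A: "A \<in> expclosure (freqs (1/2)) ?I" unfolding A_def
      by (intro expclosure_scale expclosure_add trig_polynomials_dense fin12) simp_all
    have C: "C \<in> expclosure (freqs (1/2)) ?I" unfolding C_def
      by (intro expclosure_scale expclosure_add trig_polynomials_dense)
        (use fin12 in \<open>simp_all add: norm_mult e\<close>)
    have decompose: "f1 x = A x + e x * C x" "f2 x = A x + (- e x) * C x" for x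
    proof -
      have "e x * C x = 1/2 * ((e x * e' x) * f1 x - (e x * e' x) * f2 x)"
        unfolding C_def by (simp add: algebra_simps)
      then have "e x * C x = 1/2 * (f1 x - f2 x)" by (simp add: e)
      then show "f1 x = A x + e x * C x" "f2 x = A x + (- e x) * C x"
        unfolding A_def by (simp_all add: field_simps)
    qed
    show "f \<in> expclosure (range l) ?H"
    proof (rule expclosureI[OF f])
      fix \<epsilon> :: real assume "\<epsilon> > 0"
      \<comment> \<open>The two halves of \<open>\<Omega>\<close> may contribute \<open>\<epsilon> / 2\<close> each, and on each half there are two summands,
        both with the factor \<open>2\<close> of \<open>L2_sqdist_add_le\<close>.\<close>
      obtain g where g: "g \<in> expspan (freqs (1/2))" "L2_sqdist ?I A g \<le> ennreal (\<epsilon> / 2 / 4)"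
        using expclosureD[OF A, of "\<epsilon> / 2 / 4"] \<open>\<epsilon> > 0\<close> by auto
      obtain h where h: "h \<in> expspan (freqs (1/2))" "L2_sqdist ?I C h \<le> ennreal (\<epsilon> / 2 / 4)"
        using expclosureD[OF C, of "\<epsilon> / 2 / 4"] \<open>\<epsilon> > 0\<close> by auto
      note [measurable] = expclosure_measurable[OF A] expclosure_measurable[OF C]
        expspan_measurable[OF g(1)] expspan_measurable[OF h(1)]
      define G where "G x = g x + h x * (1 * expi (1 / n * x))" for x
      have "freqs (1/2) \<subseteq> range l" "x + 1 / n \<in> range l" if "x \<in> freqs (1/2)" for x
        using that range by (auto simp: freqs_def mult.commute)
      then have G: "G \<in> expspan (range l)" unfolding G_def
        using g(1) h(1) by (intro expspan_add expspan_mult_expi[where L = "freqs (1/2)"])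
          (auto intro: expspan_mono)
      note [measurable] = expspan_measurable[OF G]
      have close: "L2_sqdist ?I (\<lambda>x. A x + d x * C x) (\<lambda>x. g x + d x * h x) \<le> ennreal (\<epsilon> / 2)"
        if [measurable]: "d \<in> borel_measurable borel" and d: "\<And>x. cmod (d x) = 1" for d
      proof -
        have "L2_sqdist ?I (\<lambda>x. A x + d x * C x) (\<lambda>x. g x + d x * h x) \<le>
          2 * L2_sqdist ?I A g + 2 * L2_sqdist ?I (\<lambda>x. d x * C x) (\<lambda>x. d x * h x)"
          by (rule L2_sqdist_add_le) measurable
        also have "\<dots> \<le> ennreal (\<epsilon> / 2)"
          unfolding L2_sqdist_unimodular[of d, OF d] using g(2) h(2) \<open>\<epsilon> > 0\<close> by (intro two_quarters_ennreal) auto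
        finally show ?thesis .
      qed
      have G1: "G x = g x + e x * h x" for x by (simp add: G_def e_def)
      have G2: "G (x + n/2) = g x + (- e x) * h x" for x
      proof -
        have "g (x + n/2) = g x" "h (x + n/2) = h x"
          using g(1) h(1) by (auto intro!: expspan_shift simp: freqs_def)
        moreover have "expi (1 / n * (x + n/2)) = - e x"
        proof -
          have "expi (1 / n * (x + n/2)) = expi (1 / n * x) * expi (1/2)"
            using \<open>n > 0\<close> by (simp add: expi_add[symmetric] field_simps)
          then show ?thesis by (simp add: e_def expi_def)
        qed
        ultimately show ?thesis by (simp add: G_def)
      qed
      have "L2_sqdist ?H f G = L2_sqdist ?I f1 G + L2_sqdist ?I f2 (\<lambda>x. G (x + n/2))"
        unfolding L2_sqdist_def by (subst fold) (simp_all add: f1_def f2_def)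
      also have "L2_sqdist ?I f1 G \<le> ennreal (\<epsilon> / 2)"
        unfolding decompose(1)[abs_def] G1[abs_def] using e by (intro close) auto
      also have "L2_sqdist ?I f2 (\<lambda>x. G (x + n/2)) \<le> ennreal (\<epsilon> / 2)"
        unfolding decompose(2)[abs_def] G2 using e by (intro close) auto
      also have "ennreal (\<epsilon> / 2) + ennreal (\<epsilon> / 2) = ennreal \<epsilon>"
        using \<open>\<epsilon> > 0\<close> by (simp flip: ennreal_plus)
      finally show "\<exists>g\<in>expspan (range l). L2_sqdist ?H f g \<le> ennreal \<epsilon>"
        using G by (auto simp: add_mono)
    qed
  qed
qed

lemma has_spectrum_if_commensurable:
  assumes commensurable
  shows "has_spectrum \<Omega>"
  using assms unfolding commensurable_def
proof
  assume "u - q \<in> \<int>"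
  then obtain k :: int where "u = q + of_int k" by (metis Ints_cases add.commute diff_add_cancel)
  then show ?thesis by (rule has_spectrum_integer_gap)
next
  assume "q - p = 1/2 \<and> 2 * (u - p) \<in> \<int>"
  then show ?thesis by (metis Ints_cases has_spectrum_equal_halves)
qed

end

section \<open>Spectral if and only if tiling\<close>

theorem theorem1p2:
  fixes I J \<Omega> :: "real set"
  assumes "is_interval I" and "is_interval J"
    and "emeasure lborel I \<noteq> 0" and "emeasure lborel J \<noteq> 0"
    and "I \<inter> J = {}"
    and "\<Omega> = I \<union> J"
    and "emeasure lborel \<Omega> = 1"
  shows "has_spectrum \<Omega> \<longleftrightarrow> tiles_by_translations \<Omega>"
proof -
  obtain p q u v where "two_intervals \<Omega> p q u v"
    using two_intervals_ordered assms by blast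
  then interpret two_intervals \<Omega> p q u v .
  show ?thesis
    using commensurable_if_spectrum commensurable_if_tiles has_spectrum_if_commensurable tiles_if_commensurable
    by blast
qed

end
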